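(* Let $p$ be a prime and let $G$ be a finite solvable group. If every cyclic subgroup of $G$ of order $p$, and also every cyclic subgroup of order $4$ in case $p=2$, is contained in $N^{\infty}_{\mathscr{U}}(G)$, then $l_p(G)\leq 2$.
   Context: All groups are finite. $\mathscr{U}$ is the class of supersolvable groups. For a group $T$, $T^{\mathscr{U}}$ is the intersection of all normal subgroups $N$ of $T$ with $T/N\in\mathscr{U}$. Put $N_{\mathscr{U}}(G)=\bigcap_{T\le G}N_G(T^{\mathscr{U}})$, over all subgroups $T$ of $G$; set $N^0_{\mathscr{U}}(G)=1$ and $N^{i+1}_{\mathscr{U}}(G)/N^{i}_{\mathscr{U}}(G)=N_{\mathscr{U}}(G/N^{i}_{\mathscr{U}}(G))$; $N^{\infty}_{\mathscr{U}}(G)$ is the terminal term of this ascending series. The $p$-length $l_p(G)$ of a $p$-solvable group is the number of (nontrivial) $p$-factors $P_i/M_{i-1}$ in the upper $p$-series $1=P_0\unlhd M_0\unlhd P_1\unlhd M_1\unlhd\cdots\unlhd P_n\unlhd M_n=G$, where $M_i/P_i=O_{p'}(G/P_i)$ and $P_i/M_{i-1}=O_p(G/M_{i-1})$. *)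

theory Defs
  imports
    "HOL-Algebra.Solvable_Groups"
    "HOL-Algebra.Group_Action"
    "HOL-Algebra.Elementary_Groups"
    "HOL-Computational_Algebra.Primes"
begin

definition supersolvable :: "('a, 'b) monoid_scheme \<Rightarrow> bool" where
  "supersolvable G \<longleftrightarrow>
     (\<exists>(n::nat) H. H 0 = {\<one>\<^bsub>G\<^esub>} \<and> H n = carrier G \<and> (\<forall>i\<le>n. H i \<lhd> G) \<and>
        (\<forall>i<n. H i \<subseteq> H (Suc i) \<and> cyclic_group ((G\<lparr>carrier := H (Suc i)\<rparr>) Mod H i)))"

definition supersolvable_residual :: "('a, 'b) monoid_scheme \<Rightarrow> 'a set" where
  "supersolvable_residual T = \<Inter> {N. N \<lhd> T \<and> supersolvable (T Mod N)}"

definition residual_norm :: "('a, 'b) monoid_scheme \<Rightarrow> 'a set" where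
  "residual_norm G =
     (\<Inter>T\<in>{T. subgroup T G}. normalizer G (supersolvable_residual (G\<lparr>carrier := T\<rparr>)))"

text \<open>
  For normal \<open>N\<close> and a subgroup \<open>K\<close> of \<open>G Mod N\<close> this is the unique
  subgroup of \<open>G\<close> that contains \<open>N\<close> and has image \<open>K\<close> in \<open>G Mod N\<close>.
\<close>
definition quotient_preimage :: "('a, 'b) monoid_scheme \<Rightarrow> 'a set \<Rightarrow> 'a set set \<Rightarrow> 'a set" where
  "quotient_preimage G N K = {x \<in> carrier G. N #>\<^bsub>G\<^esub> x \<in> K}"

primrec residual_norm_series :: "('a, 'b) monoid_scheme \<Rightarrow> nat \<Rightarrow> 'a set" where
  "residual_norm_series G 0 = {\<one>\<^bsub>G\<^esub>}"
| "residual_norm_series G (Suc i) =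
     quotient_preimage G (residual_norm_series G i)
       (residual_norm (G Mod residual_norm_series G i))"

text \<open>
  Each term of the series determines the next one, so the first repetition is the point from which
  the series is constant; it exists when \<open>G\<close> is finite.
\<close>
definition residual_norm_infinity :: "('a, 'b) monoid_scheme \<Rightarrow> 'a set" where
  "residual_norm_infinity G =
     residual_norm_series G
       (LEAST i. residual_norm_series G (Suc i) = residual_norm_series G i)"

text \<open>
  The largest normal \<open>p\<close>-subgroup and the largest normal \<open>p'\<close>-subgroup of a
  finite group, as the join of all of them.
\<close>
definition p_core :: "nat \<Rightarrow> ('a, 'b) monoid_scheme \<Rightarrow> 'a set" where
  "p_core p G = generate G (\<Union> {N. N \<lhd> G \<and> (\<exists>k. card N = p ^ k)})"

definition p'_core :: "nat \<Rightarrow> ('a, 'b) monoid_scheme \<Rightarrow> 'a set" where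
  "p'_core p G = generate G (\<Union> {N. N \<lhd> G \<and> \<not> p dvd card N})"

text \<open>
  With \<open>P\<close> and \<open>M\<close> for \<open>upper_p_series\<close> and \<open>upper_p'_series\<close> below, the upper
  \<open>p\<close>-series is \<open>1 = P 0 \<le> M 0 \<le> P 1 \<le> M 1 \<le> \<dots>\<close>, where \<open>M i\<close> is the
  \<open>p'_core_step\<close> of \<open>P i\<close> and \<open>P (Suc i)\<close> the \<open>p_core_step\<close> of \<open>M i\<close>.
\<close>
definition p_core_step :: "nat \<Rightarrow> ('a, 'b) monoid_scheme \<Rightarrow> 'a set \<Rightarrow> 'a set" where
  "p_core_step p G N = quotient_preimage G N (p_core p (G Mod N))"

definition p'_core_step :: "nat \<Rightarrow> ('a, 'b) monoid_scheme \<Rightarrow> 'a set \<Rightarrow> 'a set" where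
  "p'_core_step p G N = quotient_preimage G N (p'_core p (G Mod N))"

primrec upper_p_series :: "nat \<Rightarrow> ('a, 'b) monoid_scheme \<Rightarrow> nat \<Rightarrow> 'a set" where
  "upper_p_series p G 0 = {\<one>\<^bsub>G\<^esub>}"
| "upper_p_series p G (Suc i) = p_core_step p G (p'_core_step p G (upper_p_series p G i))"

definition upper_p'_series :: "nat \<Rightarrow> ('a, 'b) monoid_scheme \<Rightarrow> nat \<Rightarrow> 'a set" where
  "upper_p'_series p G i = p'_core_step p G (upper_p_series p G i)"

text \<open>
  Number of nontrivial \<open>p\<close>-factors. The series is not cut off when it becomes constant (which for
  a finite \<open>p\<close>-solvable group happens at \<open>carrier G\<close>), but the later factors are trivial.
  The value is only meaningful for finite \<open>p\<close>-solvable, in particular finite solvable, groups.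
\<close>
definition p_length :: "nat \<Rightarrow> ('a, 'b) monoid_scheme \<Rightarrow> nat" where
  "p_length p G = card {i. upper_p_series p G (Suc i) \<noteq> upper_p'_series p G i}"

end

theory Submission
  imports Defs "HOL-Algebra.Multiplicative_Group" "HOL-Algebra.Sylow"
begin

text \<open>
  Let \<open>K\<close> be the terminal term of the series \<open>N\<^sub>i\<close> of the \<open>residual_norm_series\<close>. The hypotheses say that
  \<open>K\<close> contains every \<open>x\<close> with \<open>x\<^sup>p = 1\<close>, or \<open>x\<^sup>4 = 1\<close> if \<open>p = 2\<close>.

  The supersolvable residual enters through commutators only. Call \<open>[a, b]\<close> a mixed commutator of a
  group \<open>T\<close> if \<open>a\<close> and \<open>b\<close> lie in the derived subgroup of \<open>T\<close>, \<open>a\<close> has \<open>p\<close>-power order and the order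
  of \<open>b\<close> is prime to \<open>p\<close>. In a supersolvable group the derived subgroup centralizes the cyclic factors
  of a normal series, so it is nilpotent and its mixed commutators are trivial. Hence the mixed
  commutators of \<open>T\<close> lie in the supersolvable residual of \<open>T\<close>, which in turn lies in \<open>T\<close>
  (\<open>mixed_commutators_subset_residual\<close>).

  Let \<open>G\<close> be solvable and \<open>A/B\<close> a chief factor of \<open>G\<close> that is a \<open>p\<close>-group, with \<open>A\<close> inside the norm
  \<open>N\<^sub>1\<close>. Then every mixed commutator of \<open>G\<close> centralizes \<open>A/B\<close>
  (\<open>mixed_commutators_centralize_chief_section\<close>). To see it, let \<open>C\<close> be the centralizer of \<open>A/B\<close>, assume
  \<open>C \<noteq> G\<close>, and take \<open>L > C\<close> normal in \<open>G\<close> with \<open>L/C\<close> a \<open>q\<close>-group and a Sylow \<open>q\<close>-subgroup \<open>S\<close> of \<open>L\<close>.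
  As \<open>A/B\<close> is chief, \<open>S\<close> has no nontrivial fixed point on it, and so \<open>q \<noteq> p\<close>. Let \<open>T\<close> be the normalizer of \<open>S\<close>. Then
  \<open>G = C T\<close> by the Frattini argument, and \<open>T \<inter> A \<subseteq> B\<close>. Elements of \<open>A\<close> normalize the residual \<open>R\<close> of \<open>T\<close>, so
  \<open>[A, R] \<subseteq> T \<inter> A \<subseteq> B\<close>, that is, \<open>R \<subseteq> C\<close>. So the mixed commutators of \<open>T\<close> lie in \<open>C\<close>, and from
  \<open>G = C T\<close> the same follows for \<open>G\<close>.

  Let \<open>E\<close> be generated by the mixed commutators of \<open>G\<close>, and let \<open>O\<close> be a maximal normal
  \<open>p'\<close>-subgroup. By coprime action, elements of \<open>E\<close> of order prime to \<open>p\<close> centralize every normal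
  \<open>p\<close>-section of \<open>G\<close> inside \<open>K\<close>, hence all elements of order \<open>p\<close> (or \<open>4\<close>) of normal \<open>p\<close>-subgroups of
  \<open>G/O\<close>. This forces them to centralize these \<open>p\<close>-subgroups (\<open>centralizes_if_centralizes_omega\<close>).
  In a solvable group without normal \<open>p'\<close>-subgroups, such centralization makes the image of \<open>E\<close> a
  \<open>p\<close>-group (\<open>p_section_if_p'_elements_centralize\<close>). Let \<open>M\<close> be a maximal normal subgroup of \<open>G\<close> that
  contains \<open>O E\<close> with \<open>M/(O E)\<close> of order prime to \<open>p\<close>. In the derived subgroup of \<open>G/M\<close>, elements of
  \<open>p\<close>-power order commute with those of order prime to \<open>p\<close>, so the same argument makes it a
  \<open>p\<close>-group. What remains is abelian. Thus \<open>G\<close> has a normal series with factors of type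
  \<open>p', p, p', p, p'\<close>, and its \<open>p\<close>-length is at most \<open>2\<close> (\<open>p_length_le_two\<close>).
\<close>

section \<open>Elements of prime power order and of order prime to p\<close>

text \<open>
  For \<open>B\<close> normal in a finite \<open>A\<close> this says that \<open>A/B\<close> is a \<open>p\<close>-group. The condition on elements
  passes to subsets of \<open>A\<close>, to larger \<open>B\<close> and to homomorphic images without any index computation.
\<close>

definition p_section :: "nat \<Rightarrow> ('a, 'b) monoid_scheme \<Rightarrow> 'a set \<Rightarrow> 'a set \<Rightarrow> bool" where
  "p_section p G A B \<longleftrightarrow> (\<forall>a\<in>A. \<exists>k::nat. a [^]\<^bsub>G\<^esub> (p ^ k) \<in> B)"

definition p'_section :: "nat \<Rightarrow> ('a, 'b) monoid_scheme \<Rightarrow> 'a set \<Rightarrow> 'a set \<Rightarrow> bool" where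
  "p'_section p G A B \<longleftrightarrow> (\<forall>a\<in>A. \<exists>m::nat. coprime m p \<and> a [^]\<^bsub>G\<^esub> m \<in> B)"

lemma (in group) inv_cancel_left [simp]:
  "\<lbrakk>x \<in> carrier G; y \<in> carrier G\<rbrakk> \<Longrightarrow> inv x \<otimes> (x \<otimes> y) = y"
  "\<lbrakk>x \<in> carrier G; y \<in> carrier G\<rbrakk> \<Longrightarrow> x \<otimes> (inv x \<otimes> y) = y"
  by (simp_all add: m_assoc[symmetric])

lemma (in group) mult_inv_eq_one_iff:
  assumes "x \<in> carrier G" "y \<in> carrier G"
  shows "x \<otimes> inv y = \<one> \<longleftrightarrow> x = y"
proof
  assume "x \<otimes> inv y = \<one>"
  moreover have "x = (x \<otimes> inv y) \<otimes> y" using assms by (simp add: m_assoc)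
  ultimately show "x = y" using assms by simp
qed (use assms in simp)

lemma (in group) conj_group_hom:
  assumes "g \<in> carrier G"
  shows "group_hom G G (\<lambda>x. g \<otimes> x \<otimes> inv g)"
  using assms by (intro group_hom.intro group_hom_axioms.intro is_group homI) (simp_all add: m_assoc)

lemma (in group) conj_pow:
  assumes "x \<in> carrier G" "y \<in> carrier G"
  shows "(x \<otimes> y \<otimes> inv x) [^] (m::nat) = x \<otimes> y [^] m \<otimes> inv x"
  by (induction m) (use assms in \<open>simp_all add: m_assoc\<close>)

lemma (in group) mem_subgroup_if_coprime_pows:
  assumes "subgroup N G" "x \<in> carrier G" "x [^] (m::nat) \<in> N" "x [^] (n::nat) \<in> N" "coprime m n"
  shows "x \<in> N"
proof -
  obtain u v where uv: "u * int m + v * int n = 1"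
    using assms(5) bezout_int[of "int m" "int n"] by (auto simp: coprime_iff_gcd_eq_1)
  have "x = x [^] (u * int m + v * int n)"
    using assms(2) uv by (simp add: int_pow_1)
  also have "\<dots> = (x [^] (int m)) [^] u \<otimes> (x [^] (int n)) [^] v"
    using assms(2) by (simp add: int_pow_mult int_pow_pow mult.commute)
  also have "\<dots> \<in> N"
    using assms(1,3,4) by (simp add: int_pow_int subgroup.m_closed subgroup_int_pow_closed)
  finally show ?thesis .
qed

lemma (in group) eq_one_if_coprime_pows:
  assumes "x \<in> carrier G" "x [^] (m::nat) = \<one>" "x [^] (n::nat) = \<one>" "coprime m n"
  shows "x = \<one>"
  using mem_subgroup_if_coprime_pows[OF triv_subgroup assms(1)] assms by simp

lemma (in group) commutator_eq_one_iff:
  assumes "x \<in> carrier G" "y \<in> carrier G"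
  shows "x \<otimes> y \<otimes> inv x \<otimes> inv y = \<one> \<longleftrightarrow> x \<otimes> y = y \<otimes> x"
  using mult_inv_eq_one_iff[of "x \<otimes> y" "y \<otimes> x"] assms by (simp add: inv_mult_group m_assoc)

text \<open>
  The conjugate of \<open>d\<close> by \<open>y\<close> is \<open>c d\<close>. When \<open>c\<close> and \<open>d\<close> commute, taking powers separates them. This
  is the elementary form of coprime action used throughout.
\<close>

lemma (in group) commutator_pow_eq_one:
  assumes "y \<in> carrier G" "d \<in> carrier G" "d [^] (m::nat) = \<one>"
    and c: "c = y \<otimes> d \<otimes> inv y \<otimes> inv d" and "c \<otimes> d = d \<otimes> c"
  shows "c [^] m = \<one>"
proof -
  have cc: "c \<in> carrier G" using assms by simp
  have "c \<otimes> d = y \<otimes> d \<otimes> inv y" using assms by (simp add: m_assoc)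
  then have "(c \<otimes> d) [^] m = \<one>" using assms conj_pow by simp
  moreover have "(c \<otimes> d) [^] m = c [^] m \<otimes> d [^] m"
    using pow_mult_distrib[OF assms(5) cc assms(2)] .
  ultimately show ?thesis using assms cc by simp
qed

lemma (in group) commute_if_coprime_commutator:
  assumes "y \<in> carrier G" "d \<in> carrier G" "d [^] (m::nat) = \<one>"
    and c: "c = y \<otimes> d \<otimes> inv y \<otimes> inv d" and "c \<otimes> d = d \<otimes> c"
    and "c [^] (n::nat) = \<one>" "coprime m n"
  shows "y \<otimes> d = d \<otimes> y"
proof -
  have "c = \<one>"
    by (rule eq_one_if_coprime_pows[OF _ commutator_pow_eq_one[OF assms(1-5)] assms(6,7)])
      (use assms in simp)
  then show ?thesis using commutator_eq_one_iff[OF assms(1,2)] c by simp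
qed

text \<open>
  The exponent \<open>j\<close> is a multiple of \<open>v\<close> that is \<open>1\<close> modulo \<open>n\<close>. It removes the part of the order of \<open>x\<close>
  that is invisible in the image.
\<close>

lemma (in group_hom) lift_coprime_order:
  assumes "x \<in> carrier G" "h x [^]\<^bsub>H\<^esub> (n::nat) = \<one>\<^bsub>H\<^esub>" "order G = u * v" "coprime n v" "v > 0"
  shows "\<exists>j::nat. (x [^] j) [^] u = \<one> \<and> h (x [^] j) = h x"
proof -
  obtain w y where w: "v * w = n * y + 1"
    using assms(4,5) bezout_nat[of v n] by (metis coprime_iff_gcd_eq_1 gcd.commute less_numeral_extra(3))
  have "(x [^] (v * w)) [^] u = (x [^] order G) [^] w"
    using assms by (simp add: G.nat_pow_pow mult_ac)
  then have "(x [^] (v * w)) [^] u = \<one>"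
    using G.pow_order_eq_1[OF assms(1)] by simp
  moreover have "h (x [^] (v * w)) = h x"
  proof -
    have "h (x [^] (v * w)) = (h x [^]\<^bsub>H\<^esub> n) [^]\<^bsub>H\<^esub> y \<otimes>\<^bsub>H\<^esub> h x"
      using assms(1) by (simp add: w hom_nat_pow H.nat_pow_pow)
    then show ?thesis using assms(1,2) by simp
  qed
  ultimately show ?thesis by blast
qed

lemma (in group) order_decompose:
  assumes "finite (carrier G)" "prime p"
  obtains a m where "order G = p ^ a * m" "coprime m p" "m > 0"
proof -
  have "order G \<noteq> 0" using assms(1) order_gt_0_iff_finite by simp
  then obtain m where m: "order G = p ^ multiplicity p (order G) * m" "\<not> p dvd m"
    using multiplicity_decompose'[of "order G" p] assms(2) by (metis not_prime_unit)
  moreover have "m > 0" using m(1) \<open>order G \<noteq> 0\<close> by (cases m) auto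
  moreover have "coprime m p"
    using m(2) assms(2) by (metis prime_imp_coprime coprime_commute)
  ultimately show ?thesis using that by blast
qed

lemma (in group_hom) lift_p_element:
  assumes "finite (carrier G)" "prime p" "x \<in> carrier G" "h x [^]\<^bsub>H\<^esub> (p ^ k :: nat) = \<one>\<^bsub>H\<^esub>"
  obtains j a :: nat where "(x [^] j) [^] (p ^ a) = \<one>" "h (x [^] j) = h x"
proof -
  obtain a m where "order G = p ^ a * m" "coprime m p" "m > 0"
    using G.order_decompose[OF assms(1,2)] by metis
  then show ?thesis
    using lift_coprime_order[OF assms(3,4), of "p ^ a" m] that by (auto simp: coprime_commute)
qed

lemma (in group_hom) lift_p'_element:
  assumes "finite (carrier G)" "prime p" "x \<in> carrier G" "h x [^]\<^bsub>H\<^esub> (n :: nat) = \<one>\<^bsub>H\<^esub>" "coprime n p"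
  obtains j m :: nat where "(x [^] j) [^] m = \<one>" "h (x [^] j) = h x" "coprime m p"
proof -
  obtain a m where "order G = m * p ^ a" "coprime m p" 
    using G.order_decompose[OF assms(1,2)] by (metis mult.commute)
  then show ?thesis
    using lift_coprime_order[OF assms(3,4), of m "p ^ a"] that assms(2,5) prime_gt_0_nat by auto
qed

lemma (in group) sylow_exists:
  assumes "finite (carrier G)" "prime p"
  obtains S a m where "subgroup S G" "card S = p ^ a" "order G = p ^ a * m" "coprime m p"
proof -
  obtain a m where *: "order G = p ^ a * m" "coprime m p"
    using order_decompose[OF assms] by metis
  show ?thesis
    using sylow_thm[OF assms(2) is_group *(1) assms(1)] that * by blast
qed

lemma (in group) pow_card_subgroup:
  assumes "subgroup S G" "x \<in> S"
  shows "x [^] card S = \<one>"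
proof -
  interpret S: group "G\<lparr>carrier := S\<rparr>" using subgroup_imp_group[OF assms(1)] .
  show ?thesis using S.pow_order_eq_1[of x] assms
    by (simp add: order_def nat_pow_consistent[symmetric])
qed

text \<open>
  A weak form of the theorem of Cauchy, which is what turns the conditions on elements in \<open>p_section\<close> and
  \<open>p'_section\<close> into statements about group orders.
\<close>

lemma (in group) cauchy_prime_power:
  assumes "finite (carrier G)" "prime q" "q dvd order G"
  obtains x and k :: nat where "x \<in> carrier G" "x \<noteq> \<one>" "x [^] (q ^ k) = \<one>"
proof -
  obtain S a m where S: "subgroup S G" "card S = q ^ a" "order G = q ^ a * m" "coprime m q"
    using sylow_exists[OF assms(1,2)] .
  have "a \<noteq> 0"
    using S(3,4) assms(2,3) by (metis coprime_absorb_right mult_1 not_prime_unit power_0)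
  then have "card S \<noteq> 1" using S(2) assms(2) by (simp add: prime_nat_iff)
  then have "S \<noteq> {\<one>}" by auto
  then obtain x where "x \<in> S" "x \<noteq> \<one>" using subgroup.one_closed[OF S(1)] by blast
  then show ?thesis using that[of x a] pow_card_subgroup[OF S(1)] S subgroup.mem_carrier[OF S(1)] by metis
qed

lemma (in group) order_prime_power:
  assumes "finite (carrier G)" "prime p" "p_section p G (carrier G) {\<one>}"
  shows "\<exists>n. order G = p ^ n"
proof -
  obtain a m where *: "order G = p ^ a * m" "coprime m p"
    using order_decompose[OF assms(1,2)] by metis
  have "m = 1"
  proof (rule ccontr)
    assume "m \<noteq> 1"
    then obtain q where q: "prime q" "q dvd m" using prime_factor_nat by blast
    then obtain x k where x: "x \<in> carrier G" "x \<noteq> \<one>" "x [^] (q ^ k) = \<one>"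
      using cauchy_prime_power[OF assms(1) q(1)] * by (metis dvd_mult)
    obtain l :: nat where "x [^] (p ^ l) = \<one>" using assms(3) x(1) by (auto simp: p_section_def)
    moreover have "coprime (q ^ k) (p ^ l)"
      using * q by (metis coprime_divisors coprime_power_left_iff coprime_power_right_iff dvd_refl)
    ultimately show False using eq_one_if_coprime_pows x by blast
  qed
  then show ?thesis using * by auto
qed

lemma (in group) order_prime_to:
  assumes "finite (carrier G)" "prime p" "p'_section p G (carrier G) {\<one>}"
  shows "\<not> p dvd order G"
proof
  assume "p dvd order G"
  then obtain x and k :: nat where x: "x \<in> carrier G" "x \<noteq> \<one>" "x [^] (p ^ k) = \<one>"
    using cauchy_prime_power[OF assms(1,2)] by metis
  obtain l :: nat where "x [^] l = \<one>" "coprime l p" using assms(3) x(1) by (auto simp: p'_section_def)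
  then show False using eq_one_if_coprime_pows x by (metis coprime_power_right_iff)
qed

lemma (in group) card_prime_power_if_p_section:
  assumes "finite (carrier G)" "prime p" "subgroup P G" "p_section p G P {\<one>}"
  shows "\<exists>k. card P = p ^ k"
proof -
  interpret P: group "G\<lparr>carrier := P\<rparr>" using subgroup_imp_group[OF assms(3)] .
  have "finite (carrier (G\<lparr>carrier := P\<rparr>))" using assms(1) subgroup.subset[OF assms(3)] finite_subset by auto
  moreover have "p_section p (G\<lparr>carrier := P\<rparr>) (carrier (G\<lparr>carrier := P\<rparr>)) {\<one>\<^bsub>G\<lparr>carrier := P\<rparr>\<^esub>}"
    using assms(4) by (simp add: p_section_def nat_pow_consistent[symmetric])
  ultimately show ?thesis using P.order_prime_power[OF _ assms(2)] by (simp add: order_def)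
qed

lemma (in group) card_prime_to_if_p'_section:
  assumes "finite (carrier G)" "prime p" "subgroup P G" "p'_section p G P {\<one>}"
  shows "\<not> p dvd card P"
proof -
  interpret P: group "G\<lparr>carrier := P\<rparr>" using subgroup_imp_group[OF assms(3)] .
  have "finite (carrier (G\<lparr>carrier := P\<rparr>))" using assms(1) subgroup.subset[OF assms(3)] finite_subset by auto
  moreover have "p'_section p (G\<lparr>carrier := P\<rparr>) (carrier (G\<lparr>carrier := P\<rparr>)) {\<one>\<^bsub>G\<lparr>carrier := P\<rparr>\<^esub>}"
    using assms(4) by (simp add: p'_section_def nat_pow_consistent[symmetric])
  ultimately show ?thesis using P.order_prime_to[OF _ assms(2)] by (simp add: order_def)
qed

section \<open>Surjective homomorphisms and quotients\<close>

locale surj_hom = group_hom +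
  assumes surj: "h ` carrier G = carrier H"
begin

lemma normal_img: "N \<lhd> G \<Longrightarrow> h ` N \<lhd> H"
  using normal.surj_hom_normal_subgroup[OF _ group_hom_axioms surj] .

lemma derived_carrier: "derived H (carrier H) = h ` derived G (carrier G)"
  using derived_img[of "carrier G"] surj by simp

lemma finite_img: "finite (carrier G) \<Longrightarrow> finite (carrier H)"
  using surj by (metis finite_imageI)

lemma solvable_img: "solvable G \<Longrightarrow> solvable H"
  using surj_hom_imp_solvable[OF surj] .

end

lemma (in group_hom) subgroup_vimage:
  assumes "subgroup K H"
  shows "subgroup {x \<in> carrier G. h x \<in> K} G"
  using assms by (unfold_locales) (auto simp: subgroup.m_closed subgroup.one_closed subgroup.m_inv_closed)

lemma (in group_hom) normal_vimage:
  assumes "K \<lhd> H"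
  shows "{x \<in> carrier G. h x \<in> K} \<lhd> G"
proof (rule G.normal_invI)
  show "subgroup {x \<in> carrier G. h x \<in> K} G"
    using subgroup_vimage normal_imp_subgroup[OF assms] .
qed (use H.normal_invE(2)[OF assms] in auto)

text \<open>
  The projection onto \<open>G Mod N\<close>, with the target abstracted to an arbitrary group \<open>H\<close> so that the
  group operations of the quotient are not unfolded into operations on cosets.
\<close>

locale quotient_hom = surj_hom +
  fixes N
  assumes hom_eq_one_iff: "x \<in> carrier G \<Longrightarrow> h x = \<one>\<^bsub>H\<^esub> \<longleftrightarrow> x \<in> N" and kernel_normal: "N \<lhd> G"
begin

lemma kernel_eq: "kernel G H h = N"
  using hom_eq_one_iff subgroup.subset[OF normal_imp_subgroup[OF kernel_normal]]
  by (auto simp: kernel_def)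

lemma pow_eq_one_iff: "x \<in> carrier G \<Longrightarrow> h x [^]\<^bsub>H\<^esub> (k::nat) = \<one>\<^bsub>H\<^esub> \<longleftrightarrow> x [^] k \<in> N"
  using hom_eq_one_iff[of "x [^] k"] by (simp add: hom_nat_pow)

lemma hom_eq_iff:
  assumes "x \<in> carrier G" "y \<in> carrier G"
  shows "h x = h y \<longleftrightarrow> x \<otimes> inv y \<in> N"
proof -
  have "h x = h y \<longleftrightarrow> h (x \<otimes> inv y) = \<one>\<^bsub>H\<^esub>"
    using assms H.mult_inv_eq_one_iff by simp
  then show ?thesis using assms hom_eq_one_iff[of "x \<otimes> inv y"] by simp
qed

lemma commute_iff:
  assumes "x \<in> carrier G" "y \<in> carrier G"
  shows "h x \<otimes>\<^bsub>H\<^esub> h y = h y \<otimes>\<^bsub>H\<^esub> h x \<longleftrightarrow> x \<otimes> y \<otimes> inv x \<otimes> inv y \<in> N"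
  using hom_eq_one_iff[of "x \<otimes> y \<otimes> inv x \<otimes> inv y"] H.commutator_eq_one_iff[of "h x" "h y"] assms
  by simp

lemma p_section_img_iff:
  assumes "A \<subseteq> carrier G"
  shows "p_section p H (h ` A) {\<one>\<^bsub>H\<^esub>} \<longleftrightarrow> p_section p G A N"
  by (simp add: p_section_def pow_eq_one_iff subsetD[OF assms])

lemma p'_section_img_iff:
  assumes "A \<subseteq> carrier G"
  shows "p'_section p H (h ` A) {\<one>\<^bsub>H\<^esub>} \<longleftrightarrow> p'_section p G A N"
  by (simp add: p'_section_def pow_eq_one_iff subsetD[OF assms])

lemma kernel_subset: "N \<subseteq> carrier G"
  using subgroup.subset[OF normal_imp_subgroup[OF kernel_normal]] .

end

lemma (in group) quotient_hom_Mod: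
  assumes "N \<lhd> G"
  shows "quotient_hom G (G Mod N) (\<lambda>x. N #> x) N"
proof -
  interpret normal N G by fact
  show ?thesis
  proof (intro quotient_hom.intro surj_hom.intro group_hom.intro group_hom_axioms.intro
      surj_hom_axioms.intro quotient_hom_axioms.intro)
    show "N #> x = \<one>\<^bsub>G Mod N\<^esub> \<longleftrightarrow> x \<in> N" if "x \<in> carrier G" for x
      using coset_join1[of N x] coset_join2[of x N] that subgroup_axioms unfolding one_FactGroup by blast
  qed (simp_all add: is_group factorgroup_is_group r_coset_hom_Mod carrier_FactGroup normal_axioms)
qed

lemma (in group) normal_torsion_subgroup:
  assumes "A \<lhd> G" and comm: "\<And>x y. x \<in> A \<Longrightarrow> y \<in> A \<Longrightarrow> x \<otimes> y = y \<otimes> x"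
  shows "{z \<in> A. \<exists>k::nat. z [^] (q ^ k :: nat) = \<one>} \<lhd> G"
proof -
  interpret A: normal A G by fact
  let ?L = "{z \<in> A. \<exists>k::nat. z [^] (q ^ k :: nat) = \<one>}"
  have "subgroup ?L G"
  proof
    show "?L \<subseteq> carrier G" using A.subset by auto
    show "\<one> \<in> ?L" by (auto simp: A.one_closed)
    fix x assume x: "x \<in> ?L"
    then obtain k where k: "x [^] (q ^ k) = \<one>" by blast
    show "inv x \<in> ?L" using x k by (auto simp: nat_pow_inv intro!: exI[of _ k])
    fix y assume y: "y \<in> ?L"
    then obtain l where l: "y [^] (q ^ l) = \<one>" by blast
    have xc: "x \<in> carrier G" "y \<in> carrier G" using x y A.subset by auto
    have "(x \<otimes> y) [^] (q ^ (k + l)) = x [^] (q ^ k * q ^ l) \<otimes> y [^] (q ^ l * q ^ k)"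
      using pow_mult_distrib[OF comm xc] x y by (simp add: power_add mult.commute)
    also have "\<dots> = \<one>" using k l xc by (simp add: nat_pow_pow[symmetric])
    finally show "x \<otimes> y \<in> ?L" using x y by auto
  qed
  moreover have "x \<otimes> h \<otimes> inv x \<in> ?L" if xh: "x \<in> carrier G" "h \<in> ?L" for x h
  proof -
    obtain k :: nat where k: "h [^] (q ^ k) = \<one>" using xh by blast
    have hc: "h \<in> carrier G" using that A.subset by auto
    show ?thesis using xh k conj_pow[OF xh(1) hc] A.inv_op_closed2 by (auto intro!: exI[of _ k])
  qed
  ultimately show ?thesis by (rule normal_invI)
qed

lemma ex_maximal_set:
  assumes "finite X" "\<forall>M. Q M \<longrightarrow> M \<subseteq> X" "Q A"
  shows "\<exists>M. Q M \<and> A \<subseteq> M \<and> (\<forall>M'. Q M' \<longrightarrow> M \<subseteq> M' \<longrightarrow> M' = M)"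
proof -
  let ?F = "{M. Q M}"
  have "?F \<subseteq> Pow X" using assms(2) by blast
  then have "finite ?F" by (rule finite_subset) (simp add: assms(1))
  moreover have "A \<in> ?F" using assms(3) by (rule CollectI)
  ultimately have "\<exists>M\<in>?F. A \<subseteq> M \<and> (\<forall>M'\<in>?F. M \<subseteq> M' \<longrightarrow> M = M')" by (rule finite_has_maximal2)
  then show ?thesis by (simp add: eq_commute)
qed

section \<open>Fixed points and Sylow subgroups\<close>

text \<open>
  Remove orbits of points that are not fixed one at a time: their lengths divide \<open>p ^ k\<close> and differ
  from \<open>1\<close>.
\<close>

lemma (in group) card_fixed_points_mod_prime:
  assumes "prime p" "order G = p ^ k" "finite Y"
    and closed: "\<And>g y. \<lbrakk>g \<in> carrier G; y \<in> Y\<rbrakk> \<Longrightarrow> \<phi> g y \<in> Y"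
    and one: "\<And>y. y \<in> Y \<Longrightarrow> \<phi> \<one> y = y"
    and mult: "\<And>g g' y. \<lbrakk>g \<in> carrier G; g' \<in> carrier G; y \<in> Y\<rbrakk> \<Longrightarrow> \<phi> (g \<otimes> g') y = \<phi> g (\<phi> g' y)"
  shows "card Y mod p = card {y \<in> Y. \<forall>g\<in>carrier G. \<phi> g y = y} mod p"
  using assms(3) closed one mult
proof (induction Y rule: finite_psubset_induct)
  case (psubset Y)
  let ?F = "\<lambda>Y. {y \<in> Y. \<forall>g\<in>carrier G. \<phi> g y = y}"
  show ?case
  proof (cases "?F Y = Y")
    case False
    then obtain y where y: "y \<in> Y" "y \<notin> ?F Y" by blast
    define \<psi> where "\<psi> = (\<lambda>g. \<lambda>y\<in>Y. \<phi> g y)"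
    have Bij: "\<psi> g \<in> Bij Y" if g: "g \<in> carrier G" for g
    proof -
      have "bij_betw (\<phi> g) Y Y"
      proof (rule bij_betwI[where g = "\<phi> (inv g)"])
        fix x assume "x \<in> Y"
        then show "\<phi> (inv g) (\<phi> g x) = x" "\<phi> g (\<phi> (inv g) x) = x"
          using psubset.prems(3)[of "inv g" g x] psubset.prems(3)[of g "inv g" x] psubset.prems(2) g
          by simp_all
      qed (use psubset.prems(1) g in auto)
      then show ?thesis by (simp add: \<psi>_def Bij_def bij_betw_restrict_eq)
    qed
    interpret A: group_action G Y \<psi>
    proof (intro group_action.intro group_hom.intro group_hom_axioms.intro homI)
      fix g g' assume g: "g \<in> carrier G" "g' \<in> carrier G"
      show "\<psi> g \<in> carrier (BijGroup Y)" using Bij[OF g(1)] by (simp add: BijGroup_def)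
      show "\<psi> (g \<otimes> g') = \<psi> g \<otimes>\<^bsub>BijGroup Y\<^esub> \<psi> g'"
        using Bij[OF g(1)] Bij[OF g(2)] psubset.prems(1,3) g
        by (auto simp: BijGroup_def compose_def \<psi>_def fun_eq_iff restrict_def)
    qed (simp_all add: is_group group_BijGroup)
    let ?O = "orbit G \<psi> y"
    have orb: "?O = (\<lambda>g. \<phi> g y) ` carrier G" using y by (auto simp: orbit_def \<psi>_def)
    have OY: "?O \<subseteq> Y" "y \<in> ?O" using orb psubset.prems(1) y A.orbit_refl by auto
    have inO: "\<phi> g z \<in> ?O" if z: "g \<in> carrier G" "z \<in> ?O" for g z
    proof -
      obtain g' where g': "g' \<in> carrier G" "z = \<phi> g' y" using z(2) orb by auto
      then have "\<phi> g z = \<phi> (g \<otimes> g') y" using psubset.prems(3) z(1) y(1) by simp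
      then show ?thesis using orb z(1) g' by auto
    qed
    have undo: "\<phi> (inv g) (\<phi> g z) = z" if "g \<in> carrier G" "z \<in> Y" for g z
      using psubset.prems(3)[of "inv g" g z] psubset.prems(2) that by simp
    have "card ?O dvd p ^ k"
      using A.orbit_stabilizer_theorem[OF y(1)] assms(2) by (metis dvd_triv_left)
    then obtain i where i: "card ?O = p ^ i" using divides_primepow_nat[OF assms(1)] by blast
    have "card ?O \<noteq> 1"
    proof
      assume "card ?O = 1"
      then obtain z where "?O = {z}" by (auto simp: card_1_singleton_iff)
      then have "\<phi> g y = y" if "g \<in> carrier G" for g using orb OY(2) imageI[OF that, of "\<lambda>g. \<phi> g y"] by simp
      then show False using y by blast
    qed
    then have "p dvd card ?O" using i by (cases i) auto
    have fixed: "?F (Y - ?O) = ?F Y"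
    proof -
      have "z \<notin> ?O" if z: "z \<in> ?F Y" for z
      proof
        assume "z \<in> ?O"
        then obtain g where g: "g \<in> carrier G" "z = \<phi> g y" using orb by auto
        then have "z = y" using undo[OF g(1) y(1)] z inv_closed[OF g(1)] by force
        then show False using y z by simp
      qed
      then show ?thesis by auto
    qed
    have "card (Y - ?O) mod p = card (?F (Y - ?O)) mod p"
    proof (rule psubset.IH)
      show "Y - ?O \<subset> Y" using OY by blast
      fix g z assume gz: "g \<in> carrier G" "z \<in> Y - ?O"
      show "\<phi> g z \<in> Y - ?O"
        using inO[of "inv g" "\<phi> g z"] undo[of g z] gz psubset.prems(1) by auto
    qed (use psubset.prems in auto)
    moreover have "card Y = card (Y - ?O) + card ?O"
      using OY(1) psubset.hyps by (simp add: card_Diff_subset card_mono finite_subset)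
    ultimately show ?thesis using fixed \<open>p dvd card ?O\<close> by (auto elim!: dvdE)
  qed simp
qed

lemma (in group_hom) order_eq_card_image_kernel:
  "order G = card (h ` carrier G) * card (kernel G H h)"
proof -
  let ?H = "H\<lparr>carrier := h ` carrier G\<rparr>"
  interpret I: group_hom G ?H h
  proof (intro group_hom.intro group_hom_axioms.intro)
    show "group ?H" using H.subgroup_imp_group[OF subgroup_img_is_subgroup[OF G.subgroup_self]] .
  qed (simp_all add: hom_def)
  have k: "kernel G ?H h = kernel G H h" by (simp add: kernel_def)
  have "card (rcosets\<^bsub>G\<^esub> kernel G H h) = card (h ` carrier G)"
    using iso_same_card[OF is_isoI[OF I.FactGroup_iso_set]] k by (simp add: FactGroup_def)
  then show ?thesis using G.lagrange[OF subgroup_kernel] by simp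
qed

lemma (in group_hom) restrict_group_hom:
  assumes "subgroup S G"
  shows "group_hom (G\<lparr>carrier := S\<rparr>) H h"
  using G.subgroup_imp_group[OF assms] subgroup.mem_carrier[OF assms] H.is_group
  by (intro group_hom.intro group_hom_axioms.intro) (auto simp: hom_def)

text \<open>
  The image of a Sylow \<open>q\<close>-subgroup in a quotient that is a \<open>q\<close>-group is everything. This follows by
  comparing the powers of \<open>q\<close> in the orders of \<open>S\<close>, \<open>C\<close> and \<open>G Mod C\<close>.
\<close>

lemma (in group) sylow_supplement:
  assumes "finite (carrier G)" "prime q" "C \<lhd> G" "p_section q G (carrier G) C"
    and S: "subgroup S G" "card S = q ^ a" "order G = q ^ a * m" "coprime m q"
    and x: "x \<in> carrier G"
  shows "\<exists>c\<in>C. \<exists>s\<in>S. x = c \<otimes> s"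
proof -
  let ?h = "\<lambda>x. C #> x" let ?Q = "G Mod C"
  interpret Q: quotient_hom G ?Q ?h C using quotient_hom_Mod[OF assms(3)] .
  interpret C: normal C G by fact
  have "p_section q ?Q (carrier ?Q) {\<one>\<^bsub>?Q\<^esub>}"
    using assms(4) Q.p_section_img_iff[of "carrier G"] Q.surj by simp
  then obtain n where n: "order ?Q = q ^ n"
    using Q.H.order_prime_power Q.finite_img assms(1,2) by blast
  note kerC = Q.kernel_eq
  have 1: "order G = q ^ n * card C"
    using Q.order_eq_card_image_kernel n by (simp add: kerC Q.surj order_def)
  interpret S: group_hom "G\<lparr>carrier := S\<rparr>" ?Q ?h using Q.restrict_group_hom[OF S(1)] .
  have "kernel (G\<lparr>carrier := S\<rparr>) ?Q ?h = C \<inter> S"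
    using kerC subgroup.subset[OF S(1)] by (auto simp: kernel_def)
  then have 2: "q ^ a = card (?h ` S) * card (C \<inter> S)"
    using S.order_eq_card_image_kernel S(2) by (simp add: order_def)
  have "subgroup (C \<inter> S) (G\<lparr>carrier := C\<rparr>)"
    using subgroup_incl[OF subgroups_Inter_pair[OF C.subgroup_axioms S(1)] C.subgroup_axioms] by simp
  from group.lagrange[OF subgroup_imp_group[OF C.subgroup_axioms] this]
  have "card (C \<inter> S) dvd card C"
  proof -
    assume "card (rcosets\<^bsub>G\<lparr>carrier := C\<rparr>\<^esub> (C \<inter> S)) * card (C \<inter> S) = order (G\<lparr>carrier := C\<rparr>)"
    then have "card C = card (rcosets\<^bsub>G\<lparr>carrier := C\<rparr>\<^esub> (C \<inter> S)) * card (C \<inter> S)" by (simp add: order_def)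
    then show ?thesis by (metis dvd_triv_right)
  qed
  then obtain t where t: "card C = card (C \<inter> S) * t" by blast
  have "card (C \<inter> S) > 0" using 2 prime_gt_0_nat[OF assms(2)] by (auto intro!: Nat.gr0I)
  moreover have "q ^ n * t * card (C \<inter> S) = card (?h ` S) * m * card (C \<inter> S)"
    using 1 2 t S(3) by (metis mult.assoc mult.commute)
  ultimately have "q ^ n * t = card (?h ` S) * m" by simp
  then have "q ^ n dvd card (?h ` S) * m" by (metis dvd_triv_left)
  then have "q ^ n dvd card (?h ` S)"
    using S(4) by (simp add: coprime_dvd_mult_left_iff coprime_commute)
  moreover have "card (?h ` S) > 0" using 2 prime_gt_0_nat[OF assms(2)] by (auto intro!: Nat.gr0I)
  ultimately have "card (carrier ?Q) \<le> card (?h ` S)" using n dvd_imp_le by (simp add: order_def)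
  moreover have "finite (carrier ?Q)" using Q.finite_img assms(1) by blast
  moreover have "?h ` S \<subseteq> carrier ?Q" using subgroup.subset[OF S(1)] Q.surj by blast
  ultimately have "?h ` S = carrier ?Q" by (intro card_seteq)
  then have "?h x \<in> ?h ` S" using Q.hom_closed[OF x] by (simp only:)
  then obtain s where s: "s \<in> S" "C #> x = C #> s" by (elim imageE)
  have sc: "s \<in> carrier G" using subgroup.mem_carrier[OF S(1) s(1)] .
  have "x \<otimes> inv s \<in> C" using s(2) Q.hom_eq_iff[OF x sc] by blast
  moreover have "x = (x \<otimes> inv s) \<otimes> s" using x sc by (simp add: m_assoc)
  ultimately show ?thesis using s(1) by blast
qed

lemma (in group) sylow_supplement_subgroup:
  assumes "finite (carrier G)" "prime q" "C \<lhd> G" "subgroup L G" "C \<subseteq> L" "p_section q G L C"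
  obtains S a m where "subgroup S G" "S \<subseteq> L" "card S = q ^ a" "card L = q ^ a * m" "coprime m q"
    "\<forall>x\<in>L. \<exists>c\<in>C. \<exists>s\<in>S. x = c \<otimes> s"
proof -
  let ?L = "G\<lparr>carrier := L\<rparr>"
  interpret L: group ?L using subgroup_imp_group[OF assms(4)] .
  have fin: "finite (carrier ?L)" using assms(1) subgroup.subset[OF assms(4)] finite_subset by auto
  obtain S a m where S: "subgroup S ?L" "card S = q ^ a" "order ?L = q ^ a * m" "coprime m q"
    using L.sylow_exists[OF fin assms(2)] .
  have "p_section q ?L (carrier ?L) C"
    using assms(6) by (simp add: p_section_def nat_pow_consistent[symmetric])
  from L.sylow_supplement[OF fin assms(2) normal_restrict_supergroup[OF assms(4,3,5)] this S]
  have "\<exists>c\<in>C. \<exists>s\<in>S. x = c \<otimes> s" if "x \<in> L" for x using that by simp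
  moreover have "subgroup S G" using incl_subgroup[OF assms(4) S(1)] .
  ultimately show ?thesis
    using that[of S a m] S subgroup.subset[OF S(1)] by (simp add: order_def)
qed

section \<open>Normal sections of finite solvable groups\<close>

text \<open>
  The last term of the derived series of \<open>E\<close> that is not inside \<open>M\<close> is abelian modulo \<open>M\<close>, and the
  \<open>q\<close>-elements of its image form a normal subgroup, nontrivial for a suitable prime \<open>q\<close>.
\<close>

lemma (in group) exists_prime_section:
  assumes "finite (carrier G)" "solvable G" "M \<lhd> G" "E \<lhd> G" "M \<subset> E"
  obtains L q where "prime q" "L \<lhd> G" "M \<subset> L" "L \<subseteq> E" "p_section q G L M"
proof -
  let ?h = "\<lambda>x. M #> x" let ?Q = "G Mod M"
  interpret Q: quotient_hom G ?Q ?h M using quotient_hom_Mod[OF assms(3)] .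
  interpret M: normal M G by fact
  interpret E: normal E G by fact
  define D where "D j = (derived G ^^ j) E" for j
  have DS: "D (Suc j) = derived G (D j)" for j by (simp add: D_def)
  have Dn: "D j \<lhd> G" for j
    by (induction j) (use derived_is_normal assms(4) in \<open>auto simp: D_def\<close>)
  have DE: "D j \<subseteq> E" for j
  proof (induction j)
    case (Suc j)
    then show ?case using derived_incl[OF _ E.subgroup_axioms] by (simp add: DS)
  qed (simp add: D_def)
  obtain n where "(derived G ^^ n) (carrier G) = {\<one>}"
    using solvable_imp_trivial_derived_seq assms(2) by (auto simp: solvable_def)
  then have "D n \<subseteq> M" using mono_exp_of_derived[OF E.subset, of n] M.one_closed by (auto simp: D_def)
  define i0 where "i0 = (LEAST j. D j \<subseteq> M)"
  have i0: "D i0 \<subseteq> M" unfolding i0_def by (rule LeastI) fact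
  have "i0 \<noteq> 0" using i0 assms(5) by (cases i0) (auto simp: D_def)
  then obtain i where i: "i0 = Suc i" by (cases i0) auto
  have ni: "\<not> D i \<subseteq> M" using not_less_Least[of i "\<lambda>j. D j \<subseteq> M"] i unfolding i0_def[symmetric] by simp
  interpret Di: normal "D i" G by (rule Dn)
  have comm: "?h x \<otimes>\<^bsub>?Q\<^esub> ?h y = ?h y \<otimes>\<^bsub>?Q\<^esub> ?h x" if xy: "x \<in> D i" "y \<in> D i" for x y
  proof -
    have "x \<otimes> y \<otimes> inv x \<otimes> inv y \<in> derived G (D i)"
      unfolding derived_def using xy by (intro generate.incl) blast
    then show ?thesis using i0 i DS Q.commute_iff xy Di.subset by auto
  qed
  obtain x where x: "x \<in> D i" "x \<notin> M" using ni by blast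
  have xc: "x \<in> carrier G" using x Di.subset by auto
  let ?P = "\<lambda>k::nat. k > 0 \<and> x [^] k \<in> M"
  \<comment> \<open>\<open>k0\<close> is the order of \<open>x\<close> modulo \<open>M\<close>; any prime divisor of it serves as \<open>q\<close>.\<close>
  define k0 where "k0 = (LEAST k. ?P k)"
  have "?P (order G)" using xc pow_order_eq_1 order_gt_0_iff_finite assms(1) M.one_closed by simp
  then have k0: "?P k0" unfolding k0_def by (rule LeastI)
  have "k0 \<noteq> 1" using k0 x xc by (metis nat_pow_eone)
  then obtain q r where q: "prime q" "k0 = q * r" using prime_factor_nat by (metis dvd_def)
  have r: "r < k0" "r > 0" using k0 q prime_gt_1_nat[OF q(1)] by (auto intro!: Nat.gr0I)
  then have nr: "x [^] r \<notin> M" using not_less_Least[of r ?P] k0_def by auto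
  let ?T = "{z \<in> ?h ` D i. \<exists>k::nat. z [^]\<^bsub>?Q\<^esub> (q ^ k :: nat) = \<one>\<^bsub>?Q\<^esub>}"
  have "?T \<lhd> ?Q"
    using comm by (intro Q.H.normal_torsion_subgroup Q.normal_img Dn) auto
  define L where "L = {z \<in> carrier G. ?h z \<in> ?T}"
  have L: "L \<lhd> G" unfolding L_def by (rule Q.normal_vimage) fact
  have in1: "?h z = \<one>\<^bsub>?Q\<^esub> \<longleftrightarrow> z \<in> M" if "z \<in> carrier G" for z
    using Q.hom_eq_one_iff[OF that] .
  have one: "\<one>\<^bsub>?Q\<^esub> \<in> ?h ` D i"
    using in1[of \<one>] Di.one_closed M.one_closed by (metis one_closed rev_image_eqI)
  have oneT: "\<one>\<^bsub>?Q\<^esub> \<in> ?T" using one Q.H.nat_pow_one by blast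
  have "M \<subseteq> L"
  proof
    fix z assume z: "z \<in> M"
    then have "?h z = \<one>\<^bsub>?Q\<^esub>" using in1 M.subset by blast
    then have "?h z \<in> ?T" using oneT by (simp only:)
    then show "z \<in> L" using z M.subset unfolding L_def by blast
  qed
  moreover have "x [^] r \<in> L"
  proof -
    have "(x [^] r) [^] (q ^ 1) \<in> M" using k0 q xc by (simp add: nat_pow_pow mult.commute)
    then have "?h (x [^] r) [^]\<^bsub>?Q\<^esub> (q ^ 1) = \<one>\<^bsub>?Q\<^esub>"
      using in1 xc by (metis Q.hom_nat_pow nat_pow_closed)
    moreover have "x [^] r \<in> D i"
      using x(1) by (induction r) (simp_all add: Di.m_closed Di.one_closed)
    ultimately show ?thesis using xc unfolding L_def by blast
  qed
  ultimately have "M \<subset> L" using nr by blast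
  moreover have "L \<subseteq> E"
  proof
    fix z assume z: "z \<in> L"
    then obtain d where d: "d \<in> D i" "?h z = ?h d" by (auto simp: L_def)
    have c: "z \<in> carrier G" "d \<in> carrier G" using z d Di.subset by (auto simp: L_def)
    have "z \<otimes> inv d \<in> M" using d(2) Q.hom_eq_iff[OF c] by blast
    then have "(z \<otimes> inv d) \<otimes> d \<in> E" using assms(5) DE d(1) by (meson E.m_closed psubsetD subsetD)
    then show "z \<in> E" using c by (simp add: m_assoc)
  qed
  moreover have "p_section q G L M"
    unfolding p_section_def
  proof
    fix z assume z: "z \<in> L"
    then obtain k :: nat where k: "?h z [^]\<^bsub>?Q\<^esub> (q ^ k) = \<one>\<^bsub>?Q\<^esub>" by (auto simp: L_def)
    have "z \<in> carrier G" using z by (simp add: L_def)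
    then have "z [^] (q ^ k) \<in> M" using k in1 by (metis Q.hom_nat_pow nat_pow_closed)
    then show "\<exists>k. z [^] (q ^ k) \<in> M" by blast
  qed
  ultimately show ?thesis using that q(1) L by blast
qed

lemma (in group) p_section_trans:
  assumes "p_section p G A B" "p_section p G B C" "A \<subseteq> carrier G"
  shows "p_section p G A C"
  unfolding p_section_def
proof
  fix a assume a: "a \<in> A"
  then obtain k :: nat where "a [^] (p ^ k) \<in> B" using assms(1) by (auto simp: p_section_def)
  then obtain l :: nat where "(a [^] (p ^ k)) [^] (p ^ l) \<in> C" using assms(2) by (auto simp: p_section_def)
  then have "a [^] (p ^ (k + l)) \<in> C" using a assms(3) by (simp add: nat_pow_pow power_add subset_iff)
  then show "\<exists>k. a [^] (p ^ k) \<in> C" by blast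
qed

lemma (in group) p'_section_trans:
  assumes "p'_section p G A B" "p'_section p G B C" "A \<subseteq> carrier G"
  shows "p'_section p G A C"
  unfolding p'_section_def
proof
  fix a assume a: "a \<in> A"
  then obtain k :: nat where k: "coprime k p" "a [^] k \<in> B" using assms(1) by (auto simp: p'_section_def)
  then obtain l :: nat where l: "coprime l p" "(a [^] k) [^] l \<in> C" using assms(2) by (auto simp: p'_section_def)
  then have "a [^] (k * l) \<in> C" using a assms(3) by (simp add: nat_pow_pow subset_iff)
  moreover have "coprime (k * l) p" using k l by simp
  ultimately show "\<exists>k. coprime k p \<and> a [^] k \<in> C" by blast
qed

text \<open>
  Take a maximal normal \<open>p\<close>-subgroup \<open>P\<close> inside \<open>E\<close>. If \<open>P \<noteq> E\<close>, there is a normal \<open>L\<close> with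
  \<open>P < L \<le> E\<close> and \<open>L/P\<close> a \<open>q\<close>-group; here \<open>q \<noteq> p\<close> by maximality. A Sylow \<open>q\<close>-subgroup of \<open>L\<close>
  centralizes \<open>P\<close>, so it consists of all \<open>q\<close>-elements of \<open>L\<close>, is normal in \<open>G\<close>, and contradicts
  \<open>no_p'\<close>. This replaces the use of the Hall-Higman lemma on centralizers of \<open>O\<^sub>p\<close>.
\<close>

lemma (in group) p_section_if_p'_elements_centralize:
  assumes fin: "finite (carrier G)" and "solvable G" "prime p" "E \<lhd> G"
    and no_p': "\<And>N. N \<lhd> G \<Longrightarrow> p'_section p G N {\<one>} \<Longrightarrow> N = {\<one>}"
    and comm: "\<And>P x d m. \<lbrakk>P \<lhd> G; P \<subseteq> E; p_section p G P {\<one>}; x \<in> P; d \<in> E;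
      d [^] (m::nat) = \<one>; coprime m p\<rbrakk> \<Longrightarrow> x \<otimes> d = d \<otimes> x"
  shows "p_section p G E {\<one>}"
proof -
  interpret E: normal E G by fact
  let ?Ps = "{P. P \<lhd> G \<and> P \<subseteq> E \<and> p_section p G P {\<one>}}"
  have one: "{\<one>} \<in> ?Ps" using one_is_normal E.one_closed by (auto simp: p_section_def)
  have sub: "\<forall>P. P \<in> ?Ps \<longrightarrow> P \<subseteq> carrier G" using E.subset by blast
  obtain P where P: "P \<in> ?Ps" and "{\<one>} \<subseteq> P" and max: "\<And>P'. P' \<in> ?Ps \<Longrightarrow> P \<subseteq> P' \<Longrightarrow> P' = P"
    using ex_maximal_set[of "carrier G" "\<lambda>P. P \<in> ?Ps", OF fin sub one] by (elim exE conjE) simp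
  have Pn: "P \<lhd> G" and PE: "P \<subseteq> E" and Pp: "p_section p G P {\<one>}" using P by simp_all
  have "P = E"
  proof (rule ccontr)
    assume "P \<noteq> E"
    then have "P \<subset> E" using PE by blast
    then obtain L q where L: "prime q" "L \<lhd> G" "P \<subset> L" "L \<subseteq> E" "p_section q G L P"
      by (rule exists_prime_section[OF fin assms(2) Pn assms(4)])
    interpret L: normal L G by (rule L(2))
    show False
    proof (cases "q = p")
      case True
      then have "p_section p G L {\<one>}" using p_section_trans[OF _ Pp L.subset] L(5) by blast
      then show False using max[of L] L(2,3,4) by auto
    next
      case False
      then have cop: "coprime (q ^ i) p" for i
        using primes_coprime[OF L(1) assms(3)] by simp
      have "P \<subseteq> L" using L(3) by blast
      then obtain S a m where S: "subgroup S G" "S \<subseteq> L" "card S = q ^ a"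
        and "card L = q ^ a * m" "coprime m q"
        and sup: "\<forall>x\<in>L. \<exists>c\<in>P. \<exists>s\<in>S. x = c \<otimes> s"
        by (rule sylow_supplement_subgroup[OF fin L(1) Pn L.subgroup_axioms _ L(5)])
      have S1: "s [^] (q ^ a) = \<one>" if "s \<in> S" for s using pow_card_subgroup[OF S(1) that] S(3) by simp
      \<comment> \<open>\<open>S\<close> is the set of all \<open>q\<close>-elements of \<open>L\<close>, so it is invariant under conjugation.\<close>
      have inS: "x \<in> S" if x: "x \<in> L" "x [^] (q ^ k) = \<one>" for x and k :: nat
      proof -
        obtain z s where zs: "z \<in> P" "s \<in> S" "x = z \<otimes> s" using sup x(1) by blast
        have zsc: "z \<in> carrier G" "s \<in> carrier G"
          using subgroup.mem_carrier[OF normal_imp_subgroup[OF Pn] zs(1)] subgroup.mem_carrier[OF S(1) zs(2)] by auto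
        have com: "z \<otimes> s = s \<otimes> z"
          using comm[OF Pn PE Pp zs(1) _ S1[OF zs(2)] cop] zs(2) S(2) L(4) by blast
        have "x [^] (q ^ k * q ^ a) = \<one>" using x zs zsc by (simp add: nat_pow_pow[symmetric])
        moreover have "s [^] (q ^ k * q ^ a) = \<one>"
          using S1[OF zs(2)] zsc by (metis mult.commute nat_pow_one nat_pow_pow)
        ultimately have "z [^] (q ^ k * q ^ a) = \<one>"
          using zs(3) zsc pow_mult_distrib[OF com zsc, of "q ^ k * q ^ a"] by simp
        then have "z [^] (q ^ (k + a)) = \<one>" by (simp add: power_add)
        moreover obtain l :: nat where "z [^] (p ^ l) = \<one>" using Pp zs(1) by (auto simp: p_section_def)
        moreover have "coprime (q ^ (k + a)) (p ^ l)" using cop[of "k + a"] by simp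
        ultimately have "z = \<one>" using eq_one_if_coprime_pows zsc by blast
        then show ?thesis using zs zsc by simp
      qed
      have "S \<lhd> G"
      proof (rule normal_invI[OF S(1)])
        fix x s assume xs: "x \<in> carrier G" "s \<in> S"
        have sc: "s \<in> carrier G" using subgroup.mem_carrier[OF S(1) xs(2)] .
        show "x \<otimes> s \<otimes> inv x \<in> S"
        proof (rule inS)
          show "x \<otimes> s \<otimes> inv x \<in> L" using L.inv_op_closed2 xs S(2) by blast
          show "(x \<otimes> s \<otimes> inv x) [^] (q ^ a) = \<one>" using conj_pow xs(1) sc S1[OF xs(2)] by simp
        qed
      qed
      moreover have "p'_section p G S {\<one>}"
        unfolding p'_section_def using S1 cop[of a] by blast
      ultimately have "S = {\<one>}" by (rule no_p')
      have "L \<subseteq> P"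
      proof
        fix x assume "x \<in> L"
        then obtain c where "c \<in> P" "x = c \<otimes> \<one>" using sup \<open>S = {\<one>}\<close> by blast
        then show "x \<in> P" using subgroup.mem_carrier[OF normal_imp_subgroup[OF Pn]] by simp
      qed
      then show False using L(3) by blast
    qed
  qed
  then show ?thesis using Pp by simp
qed

section \<open>Automorphisms of order prime to p\<close>

lemma (in group) pow_mult_central_commutator:
  assumes "x \<in> carrier G" "y \<in> carrier G" "z \<in> carrier G"
    and zx: "z \<otimes> x = x \<otimes> z" and zy: "z \<otimes> y = y \<otimes> z" and yx: "y \<otimes> x = z \<otimes> (x \<otimes> y)"
  shows "(x \<otimes> y) [^] n = x [^] n \<otimes> y [^] n \<otimes> z [^] (n choose 2)"
proof -
  have zn: "z [^] k \<otimes> x = x \<otimes> z [^] k" "z [^] k \<otimes> y = y \<otimes> z [^] k" for k :: nat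
    using group_commutes_pow[OF zx] group_commutes_pow[OF zy] assms by auto
  have zn': "z [^] k \<otimes> (y \<otimes> w) = y \<otimes> (z [^] k \<otimes> w)" if "w \<in> carrier G" for k :: nat and w
    using that assms(1-3) zn(2)[of k] by (simp add: m_assoc[symmetric])
  have ynx: "y [^] k \<otimes> x = x \<otimes> y [^] k \<otimes> z [^] k" for k :: nat
  proof (induction k)
    case (Suc k)
    have "y [^] Suc k \<otimes> x = y [^] k \<otimes> (z \<otimes> (x \<otimes> y))" using assms(1-3) yx by (simp add: m_assoc)
    also have "\<dots> = y [^] k \<otimes> x \<otimes> (y \<otimes> z)" using assms(1-3) zx zy by (metis m_assoc m_closed nat_pow_closed)
    also have "\<dots> = x \<otimes> y [^] k \<otimes> (z [^] k \<otimes> y) \<otimes> z" using Suc assms(1-3) by (simp add: m_assoc)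
    also have "\<dots> = x \<otimes> y [^] Suc k \<otimes> z [^] Suc k" using zn(2) assms(1-3) by (simp add: m_assoc)
    finally show ?case .
  qed (use assms in simp)
  show ?thesis
  proof (induction n)
    case (Suc n)
    let ?t = "n choose 2"
    have "(x \<otimes> y) [^] Suc n = x [^] n \<otimes> y [^] n \<otimes> (z [^] ?t \<otimes> x) \<otimes> y"
      using Suc assms(1-3) by (simp add: m_assoc)
    also have "\<dots> = x [^] n \<otimes> (y [^] n \<otimes> x) \<otimes> (z [^] ?t \<otimes> y)" using zn(1) assms(1-3) by (simp add: m_assoc)
    also have "\<dots> = x [^] Suc n \<otimes> y [^] n \<otimes> (z [^] n \<otimes> y) \<otimes> z [^] ?t"
      using ynx zn(2) assms(1-3) by (simp add: m_assoc zn')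
    also have "\<dots> = x [^] Suc n \<otimes> y [^] Suc n \<otimes> (z [^] n \<otimes> z [^] ?t)"
      using assms(1-3) by (simp add: m_assoc zn')
    also have "z [^] n \<otimes> z [^] ?t = z [^] (Suc n choose 2)"
      using assms(3) by (simp add: nat_pow_mult numeral_2_eq_2)
    finally show ?case .
  qed (use assms in \<open>simp add: numeral_2_eq_2\<close>)
qed

lemma (in group) subgroup_nat_pow_closed:
  assumes "subgroup M G" "x \<in> M"
  shows "x [^] (n::nat) \<in> M"
  using subgroup_int_pow_closed[OF assms, of "int n"] by (simp add: int_pow_int)

lemma (in group) centralizer_subgroup:
  assumes "z \<in> carrier G"
  shows "subgroup {y \<in> carrier G. z \<otimes> y = y \<otimes> z} G"
proof
  fix x y assume x: "x \<in> {y \<in> carrier G. z \<otimes> y = y \<otimes> z}" 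
  show "inv x \<in> {y \<in> carrier G. z \<otimes> y = y \<otimes> z}"
    using x assms by (auto) (metis inv_closed inv_solve_left' inv_solve_right m_assoc m_closed)
  assume y: "y \<in> {y \<in> carrier G. z \<otimes> y = y \<otimes> z}"
  show "x \<otimes> y \<in> {y \<in> carrier G. z \<otimes> y = y \<otimes> z}"
    using x y assms by (auto) (metis m_assoc)
qed (use assms in auto)

text \<open>
  For \<open>e = p\<close> odd, or \<open>e = 4\<close> and \<open>p = 2\<close>, this is the classical fact that a \<open>p'\<close>-automorphism of a
  \<open>p\<close>-group is determined by its action on the elements of order \<open>p\<close> (or \<open>4\<close>). By induction \<open>d\<close>
  centralizes every proper \<open>d\<close>-invariant subgroup of \<open>P\<close>. If \<open>[P, d] \<noteq> P\<close>, coprime action finishes the proof.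
  If \<open>[P, d] = P\<close>, a maximal \<open>d\<close>-invariant subgroup \<open>M\<close> containing the derived subgroup of \<open>P\<close> is
  central and \<open>P/M\<close> has exponent \<open>p\<close>. So commutators in \<open>P\<close> are central of order dividing \<open>p\<close>, the map
  \<open>x \<mapsto> x\<^sup>e\<close> is a homomorphism into \<open>M\<close>, and \<open>[x, d]\<^sup>e = [x\<^sup>e, d] = 1\<close>. Hence \<open>[x, d]\<close> is centralized by
  \<open>d\<close>, and coprime action applies again.
\<close>

lemma (in group) centralizes_if_centralizes_omega:
  assumes fin: "finite (carrier G)" and sol: "solvable G" and p: "prime p"
    and e: "p dvd e" "p dvd (e choose 2)"
    and d: "d \<in> carrier G" "d [^] (m::nat) = \<one>" "coprime m p"
    and P: "subgroup P G" "p_section p G P {\<one>}" "\<And>x. x \<in> P \<Longrightarrow> d \<otimes> x \<otimes> inv d \<in> P"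
    and omega: "\<And>x. x \<in> P \<Longrightarrow> x [^] e = \<one> \<Longrightarrow> x \<otimes> d = d \<otimes> x"
    and x: "x \<in> P"
  shows "x \<otimes> d = d \<otimes> x"
  using P omega x
proof (induction "card P" arbitrary: P x rule: less_induct)
  case less
  interpret P: subgroup P G by (rule less.prems(1))
  have pelt: "\<exists>k::nat. y [^] (p ^ k) = \<one>" if "y \<in> P" for y using less.prems(2) that by (auto simp: p_section_def)
  have finP: "finite P" using P.subset fin finite_subset by blast
  have sub: "y \<otimes> d = d \<otimes> y"
    if Q: "subgroup Q G" "Q \<subset> P" "\<And>x. x \<in> Q \<Longrightarrow> d \<otimes> x \<otimes> inv d \<in> Q" and y: "y \<in> Q" for Q y
  proof (rule less.hyps[OF _ Q(1) _ Q(3) _ y])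
    show "card Q < card P" using Q(2) finP by (rule psubset_card_mono[rotated])
    show "p_section p G Q {\<one>}" using less.prems(2) Q(2) by (auto simp: p_section_def)
    show "z \<otimes> d = d \<otimes> z" if "z \<in> Q" "z [^] e = \<one>" for z using less.prems(4) that Q(2) by blast
  qed
  define c where "c x = x \<otimes> d \<otimes> inv x \<otimes> inv d" for x
  have c: "c y = y \<otimes> (d \<otimes> inv y \<otimes> inv d)" if "y \<in> P" for y using that d(1) by (simp add: c_def m_assoc)
  have cP: "c y \<in> P" if "y \<in> P" for y using c[OF that] less.prems(3)[of "inv y"] that by simp
  have conclude: "y \<otimes> d = d \<otimes> y" if y: "y \<in> P" and "c y \<otimes> d = d \<otimes> c y" for y
  proof -
    obtain k :: nat where "c y [^] (p ^ k) = \<one>" using pelt[OF cP[OF y]] by blast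
    then show ?thesis
      using commute_if_coprime_commutator[OF _ d(1,2) c_def that(2)] d(3) y by simp
  qed
  \<comment> \<open>\<open>?W\<close> is \<open>[P, d]\<close>.\<close>
  let ?W = "generate G (c ` P)"
  have cc: "c ` P \<subseteq> P" using cP by blast
  have W: "subgroup ?W G" by (rule generate_is_subgroup[OF subset_trans[OF cc P.subset]])
  have WP: "?W \<subseteq> P" by (rule generate_subgroup_incl[OF cc less.prems(1)])
  have Wd: "d \<otimes> w \<otimes> inv d \<in> ?W" if "w \<in> ?W" for w
  proof -
    have hom: "group_hom G G (\<lambda>w. d \<otimes> w \<otimes> inv d)" by (rule conj_group_hom[OF d(1)])
    have sg: "subgroup {w \<in> carrier G. d \<otimes> w \<otimes> inv d \<in> ?W} G" using group_hom.subgroup_vimage[OF hom W] .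
    have "c ` P \<subseteq> {w \<in> carrier G. d \<otimes> w \<otimes> inv d \<in> ?W}"
    proof
      fix z assume "z \<in> c ` P"
      then obtain y where y: "y \<in> P" "z = c y" by blast
      have yc: "y \<in> carrier G" using y by simp
      have "d \<otimes> c y \<otimes> inv d = c (d \<otimes> y \<otimes> inv d)" using d(1) yc by (simp add: c_def m_assoc inv_mult_group)
      also have "\<dots> \<in> ?W" using less.prems(3)[OF y(1)] by (intro generate.incl) blast
      finally show "z \<in> {w \<in> carrier G. d \<otimes> w \<otimes> inv d \<in> ?W}" using y cP by auto
    qed
    then show ?thesis using generate_subgroup_incl[OF _ sg] that by blast
  qed
  show ?case
  proof (cases "?W = P")
    case False
    then have "c x \<otimes> d = d \<otimes> c x"
      using sub[OF W _ Wd, of "c x"] WP generate.incl[of "c x" "c ` P" G] less.prems(5) by blast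
    then show ?thesis using conclude less.prems(5) by blast
  next
    case WP: True
    show ?thesis
    proof (cases "P = {\<one>}")
      case True
      then show ?thesis using less.prems(5) d(1) by simp
    next
      case False
      have der: "derived G P \<subset> P"
      proof (rule ccontr)
        assume "\<not> derived G P \<subset> P"
        then have D: "derived G P = P" using derived_incl[OF _ less.prems(1)] by blast
        have Dn: "(derived G ^^ n) P = P" for n by (induction n) (simp_all add: D)
        obtain n where "(derived G ^^ n) (carrier G) = {\<one>}"
          using solvable_imp_trivial_derived_seq sol by (auto simp: solvable_def)
        then have "P \<subseteq> {\<one>}" using mono_exp_of_derived[OF P.subset, of n] Dn by simp
        then show False using False P.one_closed by blast
      qed
      have der_in: "a \<otimes> b \<otimes> inv a \<otimes> inv b \<in> derived G P" if "a \<in> P" "b \<in> P" for a b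
        unfolding derived_def using that by (intro generate.incl) blast
      have derd: "d \<otimes> w \<otimes> inv d \<in> derived G P" if "w \<in> derived G P" for w
      proof -
        interpret hom: group_hom G G "\<lambda>w. d \<otimes> w \<otimes> inv d" by (rule conj_group_hom[OF d(1)])
        have "(\<lambda>w. d \<otimes> w \<otimes> inv d) ` derived G P = derived G ((\<lambda>w. d \<otimes> w \<otimes> inv d) ` P)"
          using hom.derived_img[OF P.subset] by simp
        also have "\<dots> \<subseteq> derived G P" using less.prems(3) by (intro mono_derived) blast
        finally show ?thesis using that by blast
      qed
      let ?Q = "\<lambda>M. subgroup M G \<and> derived G P \<subseteq> M \<and> M \<subset> P \<and> (\<forall>x\<in>M. d \<otimes> x \<otimes> inv d \<in> M)"
      have Q0: "?Q (derived G P)" using der derd derived_is_subgroup[OF P.subset] by blast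
      have QP: "\<forall>M. ?Q M \<longrightarrow> M \<subseteq> P" by auto
      obtain M where M: "?Q M" and "derived G P \<subseteq> M" and max: "\<And>M'. ?Q M' \<Longrightarrow> M \<subseteq> M' \<Longrightarrow> M' = M"
        using ex_maximal_set[of P ?Q, OF finP QP Q0] by (elim exE conjE) simp
      have Msub: "subgroup M G" and derM: "derived G P \<subseteq> M" and MP: "M \<subset> P"
        and Minv: "\<And>x. x \<in> M \<Longrightarrow> d \<otimes> x \<otimes> inv d \<in> M"
        using M by simp_all
      interpret M: subgroup M G by (rule Msub)
      \<comment> \<open>\<open>M\<close> is normal in \<open>P\<close> and centralized by \<open>d\<close>, hence by all conjugates of \<open>d\<close> under \<open>P\<close>, hence by
        \<open>[P, d] = P\<close>.\<close>
      have Md: "z \<otimes> d = d \<otimes> z" if "z \<in> M" for z by (rule sub[OF Msub MP Minv that])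
      have Mz: "z \<otimes> y = y \<otimes> z" if z: "z \<in> M" and y: "y \<in> P" for z y
      proof -
        have zc: "z \<in> carrier G" "z \<in> P" using z MP by auto
        have "c ` P \<subseteq> {y \<in> carrier G. z \<otimes> y = y \<otimes> z}"
        proof
          fix w assume "w \<in> c ` P"
          then obtain y where y: "y \<in> P" "w = c y" by blast
          have yc: "y \<in> carrier G" using y by simp
          have "inv y \<otimes> z \<otimes> inv (inv y) \<otimes> inv z \<in> M" using der_in[of "inv y" z] y(1) zc(2) derM by (simp add: subset_iff)
          then have "inv y \<otimes> z \<otimes> inv (inv y) \<otimes> inv z \<otimes> z \<in> M" using z by (rule M.m_closed)
          then have "inv y \<otimes> z \<otimes> y \<in> M" using yc zc by (simp add: m_assoc)
          then have "inv y \<otimes> z \<otimes> y \<otimes> d = d \<otimes> (inv y \<otimes> z \<otimes> y)" by (rule Md)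
          then have "y \<otimes> (inv y \<otimes> z \<otimes> y \<otimes> d) \<otimes> inv y = y \<otimes> (d \<otimes> (inv y \<otimes> z \<otimes> y)) \<otimes> inv y" by simp
          then have *: "z \<otimes> (y \<otimes> d \<otimes> inv y) = (y \<otimes> d \<otimes> inv y) \<otimes> z" using yc zc d(1) by (simp add: m_assoc)
          have "inv d \<otimes> (d \<otimes> z) \<otimes> inv d = inv d \<otimes> (z \<otimes> d) \<otimes> inv d" using Md[OF z] by simp
          then have zd: "z \<otimes> inv d = inv d \<otimes> z" using zc d(1) by (simp add: m_assoc)
          have "z \<otimes> c y = (z \<otimes> (y \<otimes> d \<otimes> inv y)) \<otimes> inv d" using yc zc d(1) by (simp add: c_def m_assoc)
          also have "\<dots> = (y \<otimes> d \<otimes> inv y) \<otimes> (z \<otimes> inv d)" using * yc zc d(1) by (simp add: m_assoc)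
          also have "\<dots> = c y \<otimes> z" using zd yc zc d(1) by (simp add: c_def m_assoc)
          finally show "w \<in> {y \<in> carrier G. z \<otimes> y = y \<otimes> z}" using y cP by auto
        qed
        then have "?W \<subseteq> {y \<in> carrier G. z \<otimes> y = y \<otimes> z}"
          using generate_subgroup_incl centralizer_subgroup zc(1) by blast
        then show ?thesis using y WP by blast
      qed
      have formula: "(a \<otimes> b) [^] n = a [^] n \<otimes> b [^] n \<otimes> (b \<otimes> a \<otimes> inv b \<otimes> inv a) [^] (n choose 2)"
        if ab: "a \<in> P" "b \<in> P" for a b n
      proof -
        have abc: "a \<in> carrier G" "b \<in> carrier G" using ab by auto
        have "b \<otimes> a \<otimes> inv b \<otimes> inv a \<in> M" using der_in[OF ab(2,1)] derM by (rule subsetD[rotated])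
        note z = Mz[OF this ab(1)] Mz[OF this ab(2)]
        show ?thesis
          by (rule pow_mult_central_commutator[OF abc _ z]) (use abc in \<open>simp_all add: m_assoc\<close>)
      qed
      have Mpow: "a [^] n \<in> M" if "a \<in> M" for a and n :: nat
        using subgroup_nat_pow_closed[OF Msub that] .
      \<comment> \<open>Maximality of \<open>M\<close> makes \<open>P/M\<close> a group of exponent \<open>p\<close>.\<close>
      let ?N = "{x \<in> P. x [^] p \<in> M}"
      have N: "subgroup ?N G"
      proof
        show "?N \<subseteq> carrier G" by auto
        show "\<one> \<in> ?N" by simp
        fix a assume a: "a \<in> ?N"
        then show "inv a \<in> ?N" by (simp add: nat_pow_inv)
        fix b assume b: "b \<in> ?N"
        have "b \<otimes> a \<otimes> inv b \<otimes> inv a \<in> M" using der_in[of b a] a b derM by (simp add: subset_iff)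
        then show "a \<otimes> b \<in> ?N" using a b formula[of a b p] Mpow by (simp add: M.m_closed)
      qed
      have MN: "M \<subseteq> ?N" using Mpow MP by auto
      have NP: "?N = P"
      proof (rule ccontr)
        assume "?N \<noteq> P"
        moreover have "d \<otimes> a \<otimes> inv d \<in> ?N" if "a \<in> ?N" for a
          using that less.prems(3) Minv conj_pow d(1) by auto
        ultimately have "?N = M" using max[of ?N] N MN derM by auto
        then have in_M: "a \<in> M" if "a \<in> P" "a [^] p \<in> M" for a using that by blast
        have "a \<in> M" if "a \<in> P" "a [^] (p ^ k) \<in> M" for a k
          using that
        proof (induction k arbitrary: a)
          case (Suc k)
          have "a [^] p \<in> P" by (rule subgroup_nat_pow_closed[OF less.prems(1) Suc.prems(1)])
          moreover have "(a [^] p) [^] (p ^ k) \<in> M" using Suc.prems by (simp add: nat_pow_pow)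
          ultimately show ?case using Suc in_M by blast
        qed simp
        then have "P \<subseteq> M" using pelt M.one_closed by (metis subsetI)
        then show False using MP by blast
      qed
      have comm_p: "(b \<otimes> a \<otimes> inv b \<otimes> inv a) [^] p = \<one>" if ab: "a \<in> P" "b \<in> P" for a b
      proof -
        let ?z = "b \<otimes> a \<otimes> inv b \<otimes> inv a"
        have abc: "a \<in> carrier G" "b \<in> carrier G" using ab by auto
        have z: "?z \<in> M" using der_in[OF ab(2,1)] derM by (rule subsetD[rotated])
        have zc: "?z \<in> carrier G" using abc by simp
        have za: "?z \<otimes> a = b \<otimes> a \<otimes> inv b" using abc by (simp add: m_assoc)
        have "(?z \<otimes> a) [^] p = ?z [^] p \<otimes> a [^] p" using pow_mult_distrib[OF Mz[OF z ab(1)] zc abc(1)] .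
        moreover have "(?z \<otimes> a) [^] p = a [^] p"
        proof -
          have "a [^] p \<in> M" using NP ab(1) by blast
          then have "a [^] p \<otimes> b = b \<otimes> a [^] p" using Mz ab(2) by blast
          then have "b \<otimes> a [^] p \<otimes> inv b = a [^] p \<otimes> b \<otimes> inv b" by simp
          then have "b \<otimes> a [^] p \<otimes> inv b = a [^] p" using abc by (simp add: m_assoc)
          then show ?thesis using za conj_pow[OF abc(2,1)] by simp
        qed
        ultimately show ?thesis using abc zc by simp
      qed
      have xP: "x \<in> P" by (rule less.prems(5))
      have xc: "x \<in> carrier G" using xP by simp
      let ?w = "d \<otimes> inv x \<otimes> inv d"
      have wP: "?w \<in> P" using less.prems(3) xP by simp
      have xe: "x [^] e \<in> M"
      proof -
        obtain f where "e = p * f" using e(1) by blast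
        then have "x [^] e = (x [^] p) [^] f" using xc by (simp add: nat_pow_pow)
        then show ?thesis using Mpow NP xP by auto
      qed
      have "?w [^] e = d \<otimes> inv (x [^] e) \<otimes> inv d" using conj_pow d(1) xc by (simp add: nat_pow_inv)
      also have "\<dots> = inv (x [^] e)"
      proof -
        have "inv (x [^] e) \<otimes> d = d \<otimes> inv (x [^] e)" using Md[of "inv (x [^] e)"] xe by simp
        then have "d \<otimes> inv (x [^] e) \<otimes> inv d = inv (x [^] e) \<otimes> d \<otimes> inv d" by simp
        then show ?thesis using xc d(1) by (simp add: m_assoc)
      qed
      finally have we: "?w [^] e = inv (x [^] e)" .
      obtain g where g: "e choose 2 = p * g" using e(2) by blast
      have "(?w \<otimes> x \<otimes> inv ?w \<otimes> inv x) [^] (e choose 2) = ((?w \<otimes> x \<otimes> inv ?w \<otimes> inv x) [^] p) [^] g"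
        using wP xc by (simp add: g nat_pow_pow)
      then have "(?w \<otimes> x \<otimes> inv ?w \<otimes> inv x) [^] (e choose 2) = \<one>" using comm_p[OF xP wP] by simp
      then have "c x [^] e = \<one>" using formula[OF xP wP, of e] c[OF xP] we xc by simp
      then have "c x \<otimes> d = d \<otimes> c x" using less.prems(4) cP[OF xP] by blast
      then show ?thesis using conclude xP by blast
    qed
  qed
qed

section \<open>Supersolvable groups and their residuals\<close>

lemma (in group_hom) surj_hom_restrict:
  assumes "subgroup S G"
  shows "surj_hom (G\<lparr>carrier := S\<rparr>) (H\<lparr>carrier := h ` S\<rparr>) h"
proof -
  have "subgroup (h ` S) H" using subgroup_img_is_subgroup[OF assms] .
  then show ?thesis
    using G.subgroup_imp_group[OF assms] H.subgroup_imp_group subgroup.mem_carrier[OF assms]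
    by (intro surj_hom.intro group_hom.intro group_hom_axioms.intro surj_hom_axioms.intro)
      (auto simp: hom_def)
qed

lemma (in surj_hom) img_r_coset:
  assumes "K \<subseteq> carrier G" "x \<in> carrier G"
  shows "h ` (K #> x) = h ` K #>\<^bsub>H\<^esub> h x"
proof -
  have "h (k \<otimes> x) = h k \<otimes>\<^bsub>H\<^esub> h x" if "k \<in> K" for k using that assms by (intro hom_mult) auto
  then show ?thesis by (simp add: r_coset_def image_UN)
qed

lemma (in surj_hom) img_Mod:
  assumes "K \<lhd> G"
  shows "surj_hom (G Mod K) (H Mod (h ` K)) (\<lambda>X. h ` X)"
proof -
  interpret K: normal K G by fact
  interpret hK: normal "h ` K" H using normal_img[OF assms] .
  have cos: "\<exists>x\<in>carrier G. X = K #> x" if "X \<in> carrier (G Mod K)" for X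
    using that by (auto simp: carrier_FactGroup)
  have sub: "X \<subseteq> carrier G" if "X \<in> carrier (G Mod K)" for X
    using cos[OF that] G.r_coset_subset_G[OF K.subset] by blast
  show ?thesis
  proof (intro surj_hom.intro group_hom.intro group_hom_axioms.intro surj_hom_axioms.intro homI)
    show "group (G Mod K)" "group (H Mod (h ` K))"
      by (rule K.factorgroup_is_group hK.factorgroup_is_group)+
    fix X assume X: "X \<in> carrier (G Mod K)"
    then show "h ` X \<in> carrier (H Mod (h ` K))"
      using cos[OF X] img_r_coset[OF K.subset] by (auto simp: carrier_FactGroup)
    fix Y assume Y: "Y \<in> carrier (G Mod K)"
    have "h (x \<otimes> y) = h x \<otimes>\<^bsub>H\<^esub> h y" if "x \<in> X" "y \<in> Y" for x y
      using that sub[OF X] sub[OF Y] by (intro hom_mult) auto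
    then show "h ` (X \<otimes>\<^bsub>G Mod K\<^esub> Y) = h ` X \<otimes>\<^bsub>H Mod (h ` K)\<^esub> h ` Y"
      by (simp add: set_mult_def image_UN)
  next
    have "(\<lambda>X. h ` X) ` carrier (G Mod K) = (\<lambda>x. h ` K #>\<^bsub>H\<^esub> h x) ` carrier G"
      unfolding carrier_FactGroup image_image using img_r_coset[OF K.subset] by (intro image_cong) auto
    also have "\<dots> = carrier (H Mod (h ` K))"
      unfolding carrier_FactGroup surj[symmetric] image_image ..
    finally show "(\<lambda>X. h ` X) ` carrier (G Mod K) = carrier (H Mod (h ` K))" .
  qed
qed

lemma (in surj_hom) supersolvable_img:
  assumes "supersolvable G"
  shows "supersolvable H"
proof -
  obtain n :: nat and K where "K 0 = {\<one>} \<and> K n = carrier G \<and> (\<forall>i\<le>n. K i \<lhd> G) \<and>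
      (\<forall>i<n. K i \<subseteq> K (Suc i) \<and> cyclic_group ((G\<lparr>carrier := K (Suc i)\<rparr>) Mod K i))"
    using assms unfolding supersolvable_def by (elim exE)
  then have K: "K 0 = {\<one>}" "K n = carrier G" "\<And>i. i \<le> n \<Longrightarrow> K i \<lhd> G"
    "\<And>i. i < n \<Longrightarrow> K i \<subseteq> K (Suc i)"
    "\<And>i. i < n \<Longrightarrow> cyclic_group ((G\<lparr>carrier := K (Suc i)\<rparr>) Mod K i)"
    by simp_all
  have "cyclic_group ((H\<lparr>carrier := h ` K (Suc i)\<rparr>) Mod (h ` K i))" if i: "i < n" for i
  proof -
    have nS: "K (Suc i) \<lhd> G" and n: "K i \<lhd> G" using K(3) i by simp_all
    have sS: "subgroup (K (Suc i)) G" using normal_imp_subgroup[OF nS] .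
    have "K i \<lhd> G\<lparr>carrier := K (Suc i)\<rparr>"
      using G.normal_restrict_supergroup[OF sS n K(4)[OF i]] .
    then interpret I: surj_hom "(G\<lparr>carrier := K (Suc i)\<rparr>) Mod K i"
        "(H\<lparr>carrier := h ` K (Suc i)\<rparr>) Mod (h ` K i)" "\<lambda>X. h ` X"
      by (rule surj_hom.img_Mod[OF surj_hom_restrict[OF sS]])
    show ?thesis
      by (rule I.G.cyclic_group_epimorphic_image[OF _ K(5)[OF i] I.H.is_group])
        (unfold epi_def, rule CollectI, rule conjI, rule I.homh, rule I.surj)
  qed
  moreover have "h ` K 0 = {\<one>\<^bsub>H\<^esub>}" "h ` K n = carrier H" using K(1,2) surj by simp_all
  moreover have "\<forall>i\<le>n. h ` K i \<lhd> H" using K(3) normal_img by blast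
  moreover have "h ` K i \<subseteq> h ` K (Suc i)" if "i < n" for i using K(4)[OF that] by blast
  ultimately show ?thesis
    unfolding supersolvable_def by (intro exI[of _ n] exI[of _ "\<lambda>i. h ` K i"]) blast
qed

lemma (in group) supersolvable_Mod_self: "supersolvable (G Mod carrier G)"
proof -
  interpret Q: quotient_hom G "G Mod carrier G" "\<lambda>x. carrier G #> x" "carrier G"
    using quotient_hom_Mod[OF normal_self] .
  have "carrier (G Mod carrier G) = {\<one>\<^bsub>G Mod carrier G\<^esub>}"
    using Q.hom_eq_one_iff Q.surj by (auto simp: Q.surj[symmetric] simp del: one_FactGroup)
  then show ?thesis
    unfolding supersolvable_def using Q.H.one_is_normal
    by (intro exI[of _ 0] exI[of _ "\<lambda>_. {\<one>\<^bsub>G Mod carrier G\<^esub>}"]) simp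
qed

lemma (in group) residual_family_carrier:
  "carrier G \<in> {N. N \<lhd> G \<and> supersolvable (G Mod N)}"
  using normal_self supersolvable_Mod_self by simp

lemma (in group) residual_subgroup: "subgroup (supersolvable_residual G) G"
  unfolding supersolvable_residual_def
  using residual_family_carrier normal_imp_subgroup by (intro subgroups_Inter) blast+

text \<open>
  An isomorphism carries the normal subgroups with supersolvable quotient of \<open>G\<close> to such subgroups of
  \<open>H\<close>. One inclusion suffices, because the other one comes from the inverse isomorphism.
\<close>

lemma (in surj_hom) residual_img_if_inj:
  assumes inj: "inj_on h (carrier G)"
  shows "supersolvable_residual H \<subseteq> h ` supersolvable_residual G"
proof
  fix y assume y: "y \<in> supersolvable_residual H"
  have mem: "y \<in> h ` N" if N: "N \<lhd> G" "supersolvable (G Mod N)" for N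
  proof -
    have "supersolvable (H Mod (h ` N))"
      using surj_hom.supersolvable_img[OF img_Mod[OF N(1)] N(2)] .
    then show ?thesis using y normal_img[OF N(1)] by (auto simp: supersolvable_residual_def)
  qed
  obtain x where x: "x \<in> carrier G" "y = h x" using mem[OF G.normal_self G.supersolvable_Mod_self] by blast
  have "x \<in> N" if N: "N \<lhd> G" "supersolvable (G Mod N)" for N
  proof -
    have "h x \<in> h ` N" using mem[OF N] unfolding x(2) .
    then obtain z where z: "h x = h z" "z \<in> N" by (rule imageE)
    have "z \<in> carrier G" using subgroup.mem_carrier[OF normal_imp_subgroup[OF N(1)] z(2)] .
    then show ?thesis using inj_onD[OF inj z(1) x(1)] z(2) by simp
  qed
  then show "y \<in> h ` supersolvable_residual G"
    using x(2) by (auto simp: supersolvable_residual_def)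
qed

lemma (in group) residual_conj_subset:
  assumes "g \<in> carrier G" "subgroup T G"
  shows "supersolvable_residual (G\<lparr>carrier := (\<lambda>x. g \<otimes> x \<otimes> inv g) ` T\<rparr>)
    \<subseteq> (\<lambda>x. g \<otimes> x \<otimes> inv g) ` supersolvable_residual (G\<lparr>carrier := T\<rparr>)"
proof -
  interpret c: group_hom G G "\<lambda>x. g \<otimes> x \<otimes> inv g" using conj_group_hom[OF assms(1)] .
  show ?thesis
    by (rule surj_hom.residual_img_if_inj[OF c.surj_hom_restrict[OF assms(2)]])
      (use subgroup.mem_carrier[OF assms(2)] assms(1) in \<open>auto intro!: inj_onI\<close>)
qed

lemma (in group) mem_normalizer_iff:
  assumes "K \<subseteq> carrier G"
  shows "x \<in> normalizer G K \<longleftrightarrow> x \<in> carrier G \<and> (\<lambda>k. x \<otimes> k \<otimes> inv x) ` K = K"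
proof -
  have "x <# K #> inv x = (\<lambda>k. x \<otimes> k \<otimes> inv x) ` K" by (auto simp: l_coset_def r_coset_def)
  then show ?thesis using assms by (simp add: normalizer_def stabilizer_def)
qed

lemma (in group) residual_in_carrier:
  assumes "subgroup T G"
  shows "supersolvable_residual (G\<lparr>carrier := T\<rparr>) \<subseteq> T" "subgroup (supersolvable_residual (G\<lparr>carrier := T\<rparr>)) G"
proof -
  interpret T: group "G\<lparr>carrier := T\<rparr>" using subgroup_imp_group[OF assms] .
  show "supersolvable_residual (G\<lparr>carrier := T\<rparr>) \<subseteq> T" using subgroup.subset[OF T.residual_subgroup] by simp
  show "subgroup (supersolvable_residual (G\<lparr>carrier := T\<rparr>)) G"
    using incl_subgroup[OF assms T.residual_subgroup] .
qed

lemma (in group) residual_norm_iff: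
  "x \<in> residual_norm G \<longleftrightarrow> x \<in> carrier G \<and> (\<forall>T. subgroup T G \<longrightarrow>
     (\<lambda>k. x \<otimes> k \<otimes> inv x) ` supersolvable_residual (G\<lparr>carrier := T\<rparr>) = supersolvable_residual (G\<lparr>carrier := T\<rparr>))"
proof -
  have "x \<in> residual_norm G \<longleftrightarrow> (\<forall>T. subgroup T G \<longrightarrow> x \<in> normalizer G (supersolvable_residual (G\<lparr>carrier := T\<rparr>)))"
    by (auto simp: residual_norm_def)
  also have "\<dots> \<longleftrightarrow> (\<forall>T. subgroup T G \<longrightarrow> x \<in> carrier G \<and>
     (\<lambda>k. x \<otimes> k \<otimes> inv x) ` supersolvable_residual (G\<lparr>carrier := T\<rparr>) = supersolvable_residual (G\<lparr>carrier := T\<rparr>))"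
    using mem_normalizer_iff[OF subgroup.subset[OF residual_in_carrier(2)]] by blast
  finally show ?thesis using subgroup_self by blast
qed

text \<open>
  Conjugation permutes the subgroups \<open>T\<close> together with their residuals, so it preserves the
  intersection of the normalizers. Without this the quotients in the definition of the series would
  not be groups.
\<close>

lemma (in group) residual_norm_normal: "residual_norm G \<lhd> G"
proof (rule normal_invI)
  show "subgroup (residual_norm G) G"
    unfolding residual_norm_def
    by (rule subgroups_Inter)
      (use normalizer_imp_subgroup[OF subgroup.subset[OF residual_in_carrier(2)]] subgroup_self in blast)+
next
  fix g x assume g: "g \<in> carrier G" and x: "x \<in> residual_norm G"
  have xc: "x \<in> carrier G" using x residual_norm_iff by blast
  let ?R = "\<lambda>T. supersolvable_residual (G\<lparr>carrier := T\<rparr>)"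
  let ?c = "\<lambda>g x. g \<otimes> x \<otimes> inv g"
  have comp: "?c a ` ?c b ` K = ?c (a \<otimes> b) ` K" if "a \<in> carrier G" "b \<in> carrier G" "K \<subseteq> carrier G" for a b K
    unfolding image_image using that by (intro image_cong refl) (simp add: m_assoc inv_mult_group subset_iff)
  have id: "?c \<one> ` K = K" if "K \<subseteq> carrier G" for K
  proof -
    have "?c \<one> ` K = id ` K" using that by (intro image_cong refl) (simp add: subset_iff)
    then show ?thesis by simp
  qed
  have "?c (?c g x) ` ?R T = ?R T" if T: "subgroup T G" for T
  proof -
    let ?S = "?c (inv g) ` T"
    have S: "subgroup ?S G" using group_hom.subgroup_img_is_subgroup[OF conj_group_hom T] g by blast
    have RT: "?R T \<subseteq> carrier G" and RS: "?R ?S \<subseteq> carrier G"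
      using subgroup.subset[OF residual_in_carrier(2)] T S by blast+
    have TS: "?c g ` ?S = T" using comp[of g "inv g" T] id[of T] g subgroup.subset[OF T] by simp
    have 1: "?R ?S \<subseteq> ?c (inv g) ` ?R T" by (rule residual_conj_subset[OF inv_closed[OF g] T])
    have "?R T \<subseteq> ?c g ` ?R ?S" using residual_conj_subset[OF g S] unfolding TS .
    then have "?c (inv g) ` ?R T \<subseteq> ?c (inv g) ` ?c g ` ?R ?S" by (rule image_mono)
    then have "?c (inv g) ` ?R T \<subseteq> ?R ?S" using comp[of "inv g" g "?R ?S"] id[OF RS] g RS by simp
    with 1 have eq: "?c (inv g) ` ?R T = ?R ?S" by blast
    have "?c (?c g x) ` ?R T = ?c g ` ?c x ` ?c (inv g) ` ?R T"
      using comp[of x "inv g" "?R T"] comp[of g "x \<otimes> inv g" "?R T"] g xc RT by (simp add: m_assoc)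
    also have "\<dots> = ?c g ` ?R ?S" unfolding eq using x S by (simp only: residual_norm_iff)
    also have "\<dots> = ?R T" unfolding eq[symmetric] using comp[of g "inv g" "?R T"] id[OF RT] g RT by simp
    finally show ?thesis .
  qed
  then show "g \<otimes> x \<otimes> inv g \<in> residual_norm G"
    unfolding residual_norm_iff using g xc by simp
qed

lemma (in group) residual_norm_series_normal: "residual_norm_series G i \<lhd> G"
proof (induction i)
  case (Suc i)
  interpret Q: quotient_hom G "G Mod residual_norm_series G i"
      "\<lambda>x. residual_norm_series G i #> x" "residual_norm_series G i"
    using quotient_hom_Mod[OF Suc] .
  show ?case
    using Q.normal_vimage[OF Q.H.residual_norm_normal] by (simp add: quotient_preimage_def)
qed (simp add: one_is_normal)

section \<open>Commutators of p-elements and p'-elements of the derived subgroup\<close>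

definition mixed_commutators :: "nat \<Rightarrow> ('a, 'b) monoid_scheme \<Rightarrow> 'a set" where
  "mixed_commutators p G = {a \<otimes>\<^bsub>G\<^esub> b \<otimes>\<^bsub>G\<^esub> inv\<^bsub>G\<^esub> a \<otimes>\<^bsub>G\<^esub> inv\<^bsub>G\<^esub> b | a b.
     a \<in> derived G (carrier G) \<and> b \<in> derived G (carrier G) \<and>
     (\<exists>k::nat. a [^]\<^bsub>G\<^esub> (p ^ k) = \<one>\<^bsub>G\<^esub>) \<and> (\<exists>m::nat. coprime m p \<and> b [^]\<^bsub>G\<^esub> m = \<one>\<^bsub>G\<^esub>)}"

text \<open>
  Conjugations by \<open>u\<close> and \<open>v\<close> act on the cyclic group of \<open>c\<close> as power maps, and power maps commute.
\<close>

lemma (in group) derived_centralizes_normalized_cyclic: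
  assumes c: "c \<in> carrier G" and norm: "\<And>u. u \<in> carrier G \<Longrightarrow> \<exists>j::int. u \<otimes> c \<otimes> inv u = c [^] j"
    and t: "t \<in> derived G (carrier G)"
  shows "c \<otimes> t = t \<otimes> c"
proof -
  have conj: "u \<otimes> (v \<otimes> c \<otimes> inv v) \<otimes> inv u = c [^] (i * j)"
    if "u \<in> carrier G" "v \<in> carrier G" "u \<otimes> c \<otimes> inv u = c [^] i" "v \<otimes> c \<otimes> inv v = c [^] j" for u v and i j :: int
    using group_hom.hom_int_pow[OF conj_group_hom[OF that(1)] c, of j] that c by (simp add: int_pow_pow)
  have "derived_set G (carrier G) \<subseteq> {y \<in> carrier G. c \<otimes> y = y \<otimes> c}"
  proof
    fix z assume "z \<in> derived_set G (carrier G)"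
    then obtain u v where uv: "u \<in> carrier G" "v \<in> carrier G" "z = u \<otimes> v \<otimes> inv u \<otimes> inv v" by blast
    \<comment> \<open>The convention \<open>[u, v] = u v u\<inverse> v\<inverse>\<close> calls for the conjugations by the inverses.\<close>
    let ?u = "inv u" let ?v = "inv v"
    obtain i j :: int where ij: "?u \<otimes> c \<otimes> inv ?u = c [^] i" "?v \<otimes> c \<otimes> inv ?v = c [^] j"
      using norm[of ?u] norm[of ?v] uv by auto
    have "?u \<otimes> (?v \<otimes> c \<otimes> inv ?v) \<otimes> inv ?u = ?v \<otimes> (?u \<otimes> c \<otimes> inv ?u) \<otimes> inv ?v"
      using conj[of ?u ?v i j] conj[of ?v ?u j i] ij uv by (simp add: mult.commute)
    then have "u \<otimes> v \<otimes> (?v \<otimes> (?u \<otimes> c \<otimes> inv ?u) \<otimes> inv ?v) \<otimes> ?u \<otimes> ?v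
      = u \<otimes> v \<otimes> (?u \<otimes> (?v \<otimes> c \<otimes> inv ?v) \<otimes> inv ?u) \<otimes> ?u \<otimes> ?v" by simp
    then have "c \<otimes> z = z \<otimes> c" using uv c by (simp add: m_assoc)
    then show "z \<in> {y \<in> carrier G. c \<otimes> y = y \<otimes> c}" using uv by simp
  qed
  then have "derived G (carrier G) \<subseteq> {y \<in> carrier G. c \<otimes> y = y \<otimes> c}"
    unfolding derived_def by (rule generate_subgroup_incl[OF _ centralizer_subgroup[OF c]])
  then show ?thesis using t by blast
qed

lemma (in group) derived_centralizes_cyclic_section:
  assumes "K \<lhd> G" "L \<lhd> G" "K \<subseteq> L" "cyclic_group ((G\<lparr>carrier := L\<rparr>) Mod K)"
    and t: "t \<in> derived G (carrier G)" and x: "x \<in> L"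
  shows "x \<otimes> t \<otimes> inv x \<otimes> inv t \<in> K"
proof -
  interpret Q: quotient_hom G "G Mod K" "\<lambda>x. K #> x" K using quotient_hom_Mod[OF assms(1)] .
  interpret L: normal L G by fact
  let ?L = "G\<lparr>carrier := L\<rparr>"
  have nK: "K \<lhd> ?L" using normal_restrict_supergroup[OF L.subgroup_axioms assms(1,3)] .
  interpret KL: normal K ?L by (rule nK)
  interpret F: group "?L Mod K" by (rule KL.factorgroup_is_group)
  obtain X where X: "X \<in> carrier (?L Mod K)" "carrier (?L Mod K) = range (\<lambda>n::int. X [^]\<^bsub>?L Mod K\<^esub> n)"
    using assms(4) F.cyclic_group by blast
  obtain g where g: "g \<in> L" "X = K #> g" using X(1) by (auto simp: carrier_FactGroup)
  have gc: "g \<in> carrier G" using g(1) L.subset by blast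
  have pow: "\<exists>n::int. K #> y = (K #> g) [^]\<^bsub>G Mod K\<^esub> n" if y: "y \<in> L" for y
  proof -
    have "K #> y \<in> carrier (?L Mod K)" using y by (simp add: carrier_FactGroup)
    then obtain n :: int where "K #> y = X [^]\<^bsub>?L Mod K\<^esub> n" using X(2) by blast
    also have "\<dots> = K #> (g [^] n)"
      using KL.FactGroup_int_pow[of g n] g int_pow_consistent[OF L.subgroup_axioms g(1)] by simp
    also have "\<dots> = (K #> g) [^]\<^bsub>G Mod K\<^esub> n" using Q.hom_int_pow[OF gc] .
    finally show ?thesis by blast
  qed
  have tc: "t \<in> carrier G" using t derived_in_carrier by blast
  have xc: "x \<in> carrier G" using x L.subset by blast
  have comm: "(K #> g) \<otimes>\<^bsub>G Mod K\<^esub> (K #> t) = (K #> t) \<otimes>\<^bsub>G Mod K\<^esub> (K #> g)"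
  proof (rule Q.H.derived_centralizes_normalized_cyclic)
    show "K #> g \<in> carrier (G Mod K)" using Q.hom_closed[OF gc] .
    show "K #> t \<in> derived (G Mod K) (carrier (G Mod K))" using Q.derived_carrier t by blast
    fix u assume "u \<in> carrier (G Mod K)"
    then obtain v where v: "v \<in> carrier G" "u = K #> v" using Q.surj by blast
    have "u \<otimes>\<^bsub>G Mod K\<^esub> (K #> g) \<otimes>\<^bsub>G Mod K\<^esub> inv\<^bsub>G Mod K\<^esub> u = K #> (v \<otimes> g \<otimes> inv v)"
      using v gc by (simp only: Q.hom_mult Q.hom_inv m_closed inv_closed)
    then show "\<exists>j::int. u \<otimes>\<^bsub>G Mod K\<^esub> (K #> g) \<otimes>\<^bsub>G Mod K\<^esub> inv\<^bsub>G Mod K\<^esub> u = (K #> g) [^]\<^bsub>G Mod K\<^esub> j"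
      using pow[OF L.inv_op_closed2[OF v(1) g(1)]] by simp
  qed
  obtain n :: int where n: "K #> x = (K #> g) [^]\<^bsub>G Mod K\<^esub> n" using pow[OF x] by blast
  have "(K #> g) [^]\<^bsub>G Mod K\<^esub> n \<in> {y \<in> carrier (G Mod K). (K #> t) \<otimes>\<^bsub>G Mod K\<^esub> y = y \<otimes>\<^bsub>G Mod K\<^esub> (K #> t)}"
    by (rule Q.H.subgroup_int_pow_closed[OF Q.H.centralizer_subgroup[OF Q.hom_closed[OF tc]]])
      (use Q.hom_closed[OF gc] comm in simp)
  then have "(K #> x) \<otimes>\<^bsub>G Mod K\<^esub> (K #> t) = (K #> t) \<otimes>\<^bsub>G Mod K\<^esub> (K #> x)"
    unfolding n by simp
  then show ?thesis using Q.commute_iff[OF xc tc] by blast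
qed

text \<open>
  A mixed commutator \<open>c = [a, b]\<close> descends along the normal series. If it lies in one term, it commutes with
  \<open>a\<close> and with \<open>b\<close> modulo the next one, because these lie in the derived subgroup. So, modulo that term, its order divides
  both the order of \<open>a\<close> and that of \<open>b\<close>, and \<open>c\<close> is trivial.
\<close>

lemma (in group) mixed_commutators_supersolvable:
  assumes "supersolvable G"
  shows "mixed_commutators p G \<subseteq> {\<one>}"
proof
  fix c assume "c \<in> mixed_commutators p G"
  then obtain a b and k m :: nat where ab: "a \<in> derived G (carrier G)" "b \<in> derived G (carrier G)"
    and pows: "a [^] (p ^ k) = \<one>" "coprime m p" "b [^] m = \<one>" and c: "c = a \<otimes> b \<otimes> inv a \<otimes> inv b"
    unfolding mixed_commutators_def by blast
  have abc: "a \<in> carrier G" "b \<in> carrier G" using ab derived_in_carrier by blast+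
  have cc: "c \<in> carrier G" using c abc by simp
  obtain n :: nat and K where "K 0 = {\<one>} \<and> K n = carrier G \<and> (\<forall>i\<le>n. K i \<lhd> G) \<and>
      (\<forall>i<n. K i \<subseteq> K (Suc i) \<and> cyclic_group ((G\<lparr>carrier := K (Suc i)\<rparr>) Mod K i))"
    using assms unfolding supersolvable_def by (elim exE)
  then have K: "K 0 = {\<one>}" "K n = carrier G" "\<And>i. i \<le> n \<Longrightarrow> K i \<lhd> G"
    "\<And>i. i < n \<Longrightarrow> K i \<subseteq> K (Suc i)"
    "\<And>i. i < n \<Longrightarrow> cyclic_group ((G\<lparr>carrier := K (Suc i)\<rparr>) Mod K i)"
    by simp_all
  have "c \<in> K 0"
  proof (rule inc_induct[of 0 n "\<lambda>i. c \<in> K i"])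
    show "c \<in> K n" using cc K(2) by simp
    fix i assume i: "i < n" and cS: "c \<in> K (Suc i)"
    have nK: "K i \<lhd> G" and nS: "K (Suc i) \<lhd> G" using K(3) i by simp_all
    interpret Q: quotient_hom G "G Mod K i" "\<lambda>x. K i #> x" "K i" using quotient_hom_Mod[OF nK] .
    define h where "h = (\<lambda>x. K i #> x)"
    define Q where "Q = G Mod K i"
    interpret H: quotient_hom G Q h "K i" unfolding Q_def h_def by (rule Q.quotient_hom_axioms)
    have ca: "h c \<otimes>\<^bsub>Q\<^esub> h a = h a \<otimes>\<^bsub>Q\<^esub> h c" "h c \<otimes>\<^bsub>Q\<^esub> h b = h b \<otimes>\<^bsub>Q\<^esub> h c"
      using H.commute_iff[OF cc abc(1)] H.commute_iff[OF cc abc(2)]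
        derived_centralizes_cyclic_section[OF nK nS K(4)[OF i] K(5)[OF i] _ cS] ab by blast+
    have hc: "h c = h a \<otimes>\<^bsub>Q\<^esub> h b \<otimes>\<^bsub>Q\<^esub> inv\<^bsub>Q\<^esub> h a \<otimes>\<^bsub>Q\<^esub> inv\<^bsub>Q\<^esub> h b" using c abc by simp
    have hb: "h b [^]\<^bsub>Q\<^esub> m = \<one>\<^bsub>Q\<^esub>" using pows abc by (simp add: H.hom_nat_pow[symmetric])
    have ha: "h a [^]\<^bsub>Q\<^esub> (p ^ k) = \<one>\<^bsub>Q\<^esub>" using pows abc by (simp add: H.hom_nat_pow[symmetric])
    have m1: "h c [^]\<^bsub>Q\<^esub> m = \<one>\<^bsub>Q\<^esub>"
      by (rule H.H.commutator_pow_eq_one[OF _ _ hb hc ca(2)]) (use abc in simp_all)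
    have ic: "inv\<^bsub>Q\<^esub> h c = h b \<otimes>\<^bsub>Q\<^esub> h a \<otimes>\<^bsub>Q\<^esub> inv\<^bsub>Q\<^esub> h b \<otimes>\<^bsub>Q\<^esub> inv\<^bsub>Q\<^esub> h a"
      unfolding hc using abc by (simp add: H.H.inv_mult_group H.H.m_assoc)
    have "h a \<otimes>\<^bsub>Q\<^esub> inv\<^bsub>Q\<^esub> h c = inv\<^bsub>Q\<^esub> h c \<otimes>\<^bsub>Q\<^esub> h a"
    proof -
      have "inv\<^bsub>Q\<^esub> h c \<otimes>\<^bsub>Q\<^esub> (h c \<otimes>\<^bsub>Q\<^esub> h a) \<otimes>\<^bsub>Q\<^esub> inv\<^bsub>Q\<^esub> h c = inv\<^bsub>Q\<^esub> h c \<otimes>\<^bsub>Q\<^esub> (h a \<otimes>\<^bsub>Q\<^esub> h c) \<otimes>\<^bsub>Q\<^esub> inv\<^bsub>Q\<^esub> h c"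
        by (simp only: ca)
      then show ?thesis using abc cc by (simp add: H.H.m_assoc del: H.hom_mult)
    qed
    then have "(inv\<^bsub>Q\<^esub> h c) [^]\<^bsub>Q\<^esub> (p ^ k) = \<one>\<^bsub>Q\<^esub>"
      by (intro H.H.commutator_pow_eq_one[OF _ _ ha ic]) (use abc in simp_all)
    then have m2: "h c [^]\<^bsub>Q\<^esub> (p ^ k) = \<one>\<^bsub>Q\<^esub>"
      using cc by (simp add: H.H.nat_pow_inv)
    have "h c = \<one>\<^bsub>Q\<^esub>"
      by (rule H.H.eq_one_if_coprime_pows[OF _ m1 m2]) (use cc pows(2) in simp_all)
    then show "c \<in> K i" using H.hom_eq_one_iff[OF cc] by blast
  qed simp
  then show "c \<in> {\<one>}" using K(1) by simp
qed

lemma (in group_hom) mixed_commutators_img: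
  "h ` mixed_commutators p G \<subseteq> mixed_commutators p H"
proof
  fix z assume "z \<in> h ` mixed_commutators p G"
  then obtain a b and k m :: nat where ab: "a \<in> derived G (carrier G)" "b \<in> derived G (carrier G)"
    and pows: "a [^] (p ^ k) = \<one>" "coprime m p" "b [^] m = \<one>" and z: "z = h (a \<otimes> b \<otimes> inv a \<otimes> inv b)"
    unfolding mixed_commutators_def by blast
  have abc: "a \<in> carrier G" "b \<in> carrier G" using ab G.derived_in_carrier by blast+
  have "derived H (h ` carrier G) \<subseteq> derived H (carrier H)" by (intro H.mono_derived) auto
  then have "h a \<in> derived H (carrier H)" "h b \<in> derived H (carrier H)"
    using ab derived_img[of "carrier G"] by auto
  moreover have "h a [^]\<^bsub>H\<^esub> (p ^ k) = \<one>\<^bsub>H\<^esub>" "h b [^]\<^bsub>H\<^esub> m = \<one>\<^bsub>H\<^esub>"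
    using pows abc by (simp_all add: hom_nat_pow[symmetric])
  moreover have "z = h a \<otimes>\<^bsub>H\<^esub> h b \<otimes>\<^bsub>H\<^esub> inv\<^bsub>H\<^esub> h a \<otimes>\<^bsub>H\<^esub> inv\<^bsub>H\<^esub> h b" using z abc by simp
  ultimately show "z \<in> mixed_commutators p H" unfolding mixed_commutators_def using pows(2) by blast
qed

lemma (in group) mixed_commutators_subset_carrier: "mixed_commutators p G \<subseteq> carrier G"
  unfolding mixed_commutators_def using subsetD[OF derived_in_carrier[OF subset_refl]] by auto

lemma (in group) mixed_commutators_subset_residual:
  "mixed_commutators p G \<subseteq> supersolvable_residual G"
proof -
  have "mixed_commutators p G \<subseteq> N" if N: "N \<lhd> G" "supersolvable (G Mod N)" for N
  proof
    fix z assume z: "z \<in> mixed_commutators p G"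
    interpret Q: quotient_hom G "G Mod N" "\<lambda>x. N #> x" N using quotient_hom_Mod[OF N(1)] .
    have "N #> z = \<one>\<^bsub>G Mod N\<^esub>"
      using Q.mixed_commutators_img Q.H.mixed_commutators_supersolvable[OF N(2)] z by blast
    then show "z \<in> N" using Q.hom_eq_one_iff z mixed_commutators_subset_carrier by blast
  qed
  then show ?thesis by (auto simp: supersolvable_residual_def)
qed

section \<open>Sylow conjugacy and the Frattini argument\<close>

text \<open>
  The \<open>q\<close>-group \<open>R\<close> acts on the cosets of \<open>S\<close>, whose number \<open>m\<close> is prime to \<open>q\<close>, and so fixes one.
\<close>

lemma (in group) sylow_conjugate:
  assumes "finite (carrier G)" "prime q"
    and S: "subgroup S G" "card S = q ^ a" "order G = q ^ a * m" "coprime m q"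
    and R: "subgroup R G" "card R = q ^ b"
  shows "\<exists>y\<in>carrier G. \<forall>r\<in>R. y \<otimes> r \<otimes> inv y \<in> S"
proof -
  interpret S: subgroup S G by (rule S(1))
  interpret R: subgroup R G by (rule R(1))
  let ?R = "G\<lparr>carrier := R\<rparr>"
  interpret RG: group ?R using subgroup_imp_group[OF R(1)] .
  let ?Y = "rcosets S"
  define \<phi> where "\<phi> r Y = Y #> inv r" for r Y
  have coset: "\<exists>y\<in>carrier G. Y = S #> y" if "Y \<in> ?Y" for Y using that by (auto simp: RCOSETS_def)
  have act: "\<phi> r (S #> y) = S #> (y \<otimes> inv r)" if "r \<in> R" "y \<in> carrier G" for r y
    using that by (simp add: \<phi>_def coset_mult_assoc S.subset)
  have finY: "finite ?Y" by (simp add: RCOSETS_def assms(1))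
  have "card ?Y mod q = card {Y \<in> ?Y. \<forall>r\<in>carrier ?R. \<phi> r Y = Y} mod q"
  proof (rule RG.card_fixed_points_mod_prime[OF assms(2) _ finY])
    show "order ?R = q ^ b" using R(2) by (simp add: order_def)
    fix r Y assume "r \<in> carrier ?R" "Y \<in> ?Y"
    then obtain y where y: "r \<in> R" "y \<in> carrier G" "Y = S #> y" using coset by auto
    then show "\<phi> r Y \<in> ?Y" using act rcosetsI[OF S.subset] by simp
  next
    fix Y assume "Y \<in> ?Y"
    then obtain y where y: "y \<in> carrier G" "Y = S #> y" using coset by auto
    then show "\<phi> \<one>\<^bsub>?R\<^esub> Y = Y" using act[OF R.one_closed] by simp
  next
    fix r r' Y assume "r \<in> carrier ?R" "r' \<in> carrier ?R" "Y \<in> ?Y"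
    then obtain y where y: "r \<in> R" "r' \<in> R" "y \<in> carrier G" "Y = S #> y" using coset by auto
    then show "\<phi> (r \<otimes>\<^bsub>?R\<^esub> r') Y = \<phi> r (\<phi> r' Y)"
      using act by (simp add: inv_mult_group m_assoc)
  qed
  moreover have "card ?Y = m"
  proof -
    have "card ?Y * q ^ a = m * q ^ a" using lagrange[OF S(1)] unfolding S(2,3) by (simp only: mult.commute)
    moreover have "q ^ a \<noteq> 0" using prime_gt_0_nat[OF assms(2)] by simp
    ultimately show ?thesis by (simp only: mult_cancel2 simp_thms)
  qed
  moreover have "m mod q \<noteq> 0"
    using S(4) assms(2) by (metis coprime_absorb_right mod_0_imp_dvd not_prime_unit)
  ultimately have "card {Y \<in> ?Y. \<forall>r\<in>carrier ?R. \<phi> r Y = Y} \<noteq> 0" by (metis mod_0)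
  then have "{Y \<in> ?Y. \<forall>r\<in>carrier ?R. \<phi> r Y = Y} \<noteq> {}" by (metis card.empty)
  then obtain Y where "Y \<in> ?Y" and fixed: "\<forall>r\<in>R. \<phi> r Y = Y" by auto
  then obtain y where y: "y \<in> carrier G" "Y = S #> y" using coset by blast
  have "y \<otimes> r \<otimes> inv y \<in> S" if r: "r \<in> R" for r
  proof -
    have rc: "r \<in> carrier G" using r by simp
    have "S #> (y \<otimes> inv (inv r)) = S #> y"
      using act[of "inv r" y] fixed r y by simp
    then have "y \<otimes> r \<in> S #> y" using rcos_self[of "y \<otimes> r" S] S(1) y(1) rc by simp
    then show ?thesis using S.rcos_module_imp[OF is_group y(1)] by simp
  qed
  then show ?thesis using y(1) by blast
qed

lemma (in group) frattini_argument:
  assumes fin: "finite (carrier G)" and "prime q" "L \<lhd> G"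
    and S: "subgroup S G" "S \<subseteq> L" "card S = q ^ a" "card L = q ^ a * m" "coprime m q"
    and x: "x \<in> carrier G"
  shows "\<exists>l\<in>L. \<exists>t\<in>normalizer G S. x = l \<otimes> t"
proof -
  interpret L: normal L G by fact
  interpret S: subgroup S G by (rule S(1))
  let ?L = "G\<lparr>carrier := L\<rparr>"
  interpret LG: group ?L using subgroup_imp_group[OF L.subgroup_axioms] .
  let ?c = "\<lambda>y s. y \<otimes> s \<otimes> inv y"
  have finS: "finite S" using S.subset fin finite_subset by blast
  have inj: "inj_on (?c y) S" if "y \<in> carrier G" for y using that by (auto intro!: inj_onI)
  have sR: "subgroup (?c x ` S) G" using group_hom.subgroup_img_is_subgroup[OF conj_group_hom[OF x] S(1)] .
  have RL: "?c x ` S \<subseteq> L" using L.inv_op_closed2[OF x] S(2) by blast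
  have "\<exists>y\<in>carrier ?L. \<forall>r\<in>?c x ` S. y \<otimes>\<^bsub>?L\<^esub> r \<otimes>\<^bsub>?L\<^esub> inv\<^bsub>?L\<^esub> y \<in> S"
  proof (rule LG.sylow_conjugate[OF _ assms(2) _ S(3) _ S(5)])
    show "finite (carrier ?L)" using L.subset fin finite_subset by auto
    show "subgroup S ?L" using subgroup_incl[OF S(1) L.subgroup_axioms S(2)] .
    show "order ?L = q ^ a * m" using S(4) by (simp add: order_def)
    show "subgroup (?c x ` S) ?L" using subgroup_incl[OF sR L.subgroup_axioms RL] .
    show "card (?c x ` S) = q ^ a" using card_image[OF inj[OF x]] S(3) by simp
  qed
  then obtain y where y: "y \<in> L" "\<forall>s\<in>S. y \<otimes> (x \<otimes> s \<otimes> inv x) \<otimes> inv y \<in> S"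
    using L.subgroup_axioms by auto
  have yc: "y \<in> carrier G" using y(1) by simp
  have sub: "?c (y \<otimes> x) ` S \<subseteq> S"
    using y(2) yc x by (auto simp: inv_mult_group m_assoc)
  have "?c (y \<otimes> x) ` S = S"
    using card_image[OF inj[of "y \<otimes> x"]] yc x by (intro card_subset_eq finS sub) simp
  then have "y \<otimes> x \<in> normalizer G S" using mem_normalizer_iff[OF S.subset] yc x by simp
  moreover have "x = inv y \<otimes> (y \<otimes> x)" using yc x by simp
  moreover have "inv y \<in> L" using y(1) by simp
  ultimately show ?thesis by blast
qed

section \<open>Centralizers of normal sections\<close>

definition section_centralizer :: "('a, 'b) monoid_scheme \<Rightarrow> 'a set \<Rightarrow> 'a set \<Rightarrow> 'a set" where
  "section_centralizer G A B =
     {g \<in> carrier G. \<forall>a\<in>A. a \<otimes>\<^bsub>G\<^esub> g \<otimes>\<^bsub>G\<^esub> inv\<^bsub>G\<^esub> a \<otimes>\<^bsub>G\<^esub> inv\<^bsub>G\<^esub> g \<in> B}"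

lemma (in quotient_hom) mem_section_centralizer_iff:
  assumes "A \<subseteq> carrier G" "g \<in> carrier G"
  shows "g \<in> section_centralizer G A N \<longleftrightarrow> (\<forall>a\<in>A. h a \<otimes>\<^bsub>H\<^esub> h g = h g \<otimes>\<^bsub>H\<^esub> h a)"
  unfolding section_centralizer_def using assms commute_iff by blast

lemma (in group) centralizer_normal:
  assumes "A \<lhd> G"
  shows "{y \<in> carrier G. \<forall>a\<in>A. a \<otimes> y = y \<otimes> a} \<lhd> G"
proof -
  interpret A: normal A G by fact
  have eq: "{y \<in> carrier G. \<forall>a\<in>A. a \<otimes> y = y \<otimes> a} = \<Inter> ((\<lambda>a. {y \<in> carrier G. a \<otimes> y = y \<otimes> a}) ` A)"
    using A.one_closed by blast
  have "subgroup {y \<in> carrier G. \<forall>a\<in>A. a \<otimes> y = y \<otimes> a} G"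
    unfolding eq
  proof (rule subgroups_Inter)
    show "(\<lambda>a. {y \<in> carrier G. a \<otimes> y = y \<otimes> a}) ` A \<noteq> {}" using A.one_closed by blast
  qed (use centralizer_subgroup in auto)
  moreover have "x \<otimes> y \<otimes> inv x \<in> {y \<in> carrier G. \<forall>a\<in>A. a \<otimes> y = y \<otimes> a}"
    if x: "x \<in> carrier G" and y: "y \<in> {y \<in> carrier G. \<forall>a\<in>A. a \<otimes> y = y \<otimes> a}" for x y
  proof -
    have yc: "y \<in> carrier G" using y by simp
    have "a \<otimes> (x \<otimes> y \<otimes> inv x) = x \<otimes> y \<otimes> inv x \<otimes> a" if a: "a \<in> A" for a
    proof -
      have ac: "a \<in> carrier G" using a by simp
      have "inv x \<otimes> a \<otimes> x \<in> A" using A.inv_op_closed1[OF x a] .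
      then have "(inv x \<otimes> a \<otimes> x) \<otimes> y = y \<otimes> (inv x \<otimes> a \<otimes> x)" using y by blast
      then have "x \<otimes> ((inv x \<otimes> a \<otimes> x) \<otimes> y) \<otimes> inv x = x \<otimes> (y \<otimes> (inv x \<otimes> a \<otimes> x)) \<otimes> inv x" by simp
      then show ?thesis using ac x yc by (simp add: m_assoc)
    qed
    then show ?thesis using x yc by simp
  qed
  ultimately show ?thesis by (rule normal_invI)
qed

lemma (in group) section_centralizer_normal:
  assumes "A \<lhd> G" "B \<lhd> G"
  shows "section_centralizer G A B \<lhd> G"
proof -
  interpret Q: quotient_hom G "G Mod B" "\<lambda>x. B #> x" B using quotient_hom_Mod[OF assms(2)] .
  let ?h = "\<lambda>x. B #> x" let ?Q = "G Mod B"
  have sub: "A \<subseteq> carrier G" using subgroup.subset[OF normal_imp_subgroup[OF assms(1)]] .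
  have "section_centralizer G A B = {x \<in> carrier G. ?h x \<in> {y \<in> carrier ?Q. \<forall>a\<in>?h ` A. a \<otimes>\<^bsub>?Q\<^esub> y = y \<otimes>\<^bsub>?Q\<^esub> a}}"
    (is "?L = ?R")
  proof (rule equalityI; rule subsetI)
    fix x assume x: "x \<in> ?L"
    then have "x \<in> carrier G" by (simp add: section_centralizer_def)
    then show "x \<in> ?R" using x Q.mem_section_centralizer_iff[OF sub] Q.hom_closed by blast
  next
    fix x assume "x \<in> ?R"
    then show "x \<in> ?L" using Q.mem_section_centralizer_iff[OF sub] by blast
  qed
  then show ?thesis
    using Q.normal_vimage[OF Q.H.centralizer_normal[OF Q.normal_img[OF assms(1)]]] by simp
qed

lemma (in group) commutator_swap_mem:
  assumes "subgroup B G" "a \<in> carrier G" "g \<in> carrier G" "a \<otimes> g \<otimes> inv a \<otimes> inv g \<in> B"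
  shows "g \<otimes> a \<otimes> inv g \<otimes> inv a \<in> B"
proof -
  have "g \<otimes> a \<otimes> inv g \<otimes> inv a = inv (a \<otimes> g \<otimes> inv a \<otimes> inv g)"
    using assms(2,3) by (simp add: inv_mult_group m_assoc)
  then show ?thesis using subgroup.m_inv_closed[OF assms(1,4)] by simp
qed

text \<open>
  The elements of \<open>A\<close> that are centralized by \<open>S\<close> modulo \<open>B\<close> are those centralized by \<open>L\<close>, since \<open>L\<close>
  is generated by \<open>S\<close> and the centralizer of \<open>A/B\<close>. They form a normal subgroup of \<open>G\<close>, which is
  \<open>A\<close> or \<open>B\<close>, and \<open>A\<close> is impossible because \<open>L\<close> does not centralize \<open>A/B\<close>.
\<close>

lemma (in group) chief_section_fixed_points:
  assumes A: "A \<lhd> G" and B: "B \<lhd> G" "B \<subseteq> A"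
    and chief: "\<And>M. M \<lhd> G \<Longrightarrow> B \<subseteq> M \<Longrightarrow> M \<subseteq> A \<Longrightarrow> M = B \<or> M = A"
    and L: "L \<lhd> G" "\<not> L \<subseteq> section_centralizer G A B"
    and sup: "\<forall>x\<in>L. \<exists>c\<in>section_centralizer G A B. \<exists>s\<in>S. x = c \<otimes> s"
    and S: "S \<subseteq> carrier G"
    and a: "a \<in> A" and fixed: "\<forall>s\<in>S. a \<otimes> s \<otimes> inv a \<otimes> inv s \<in> B"
  shows "a \<in> B"
proof -
  interpret A: normal A G by (rule A)
  interpret B: normal B G by (rule B(1))
  interpret L: normal L G by (rule L(1))
  interpret Q: quotient_hom G "G Mod B" "\<lambda>x. B #> x" B using quotient_hom_Mod[OF B(1)] .
  let ?C = "section_centralizer G A B"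
  let ?F = "A \<inter> section_centralizer G L B"
  have F: "?F \<lhd> G" using normal_subgroup_intersect[OF A section_centralizer_normal[OF L(1) B(1)]] .
  have "B \<subseteq> section_centralizer G L B"
  proof
    fix b assume b: "b \<in> B"
    have "l \<otimes> b \<otimes> inv l \<otimes> inv b \<in> B" if "l \<in> L" for l
      using B.inv_op_closed2[of l b] that b by simp
    then show "b \<in> section_centralizer G L B" using b by (simp add: section_centralizer_def)
  qed
  then have "?F = B \<or> ?F = A" using chief[OF F] B(2) by blast
  moreover have "?F \<noteq> A"
  proof
    assume FA: "?F = A"
    have "L \<subseteq> ?C"
    proof
      fix l assume l: "l \<in> L"
      have "x \<otimes> l \<otimes> inv x \<otimes> inv l \<in> B" if "x \<in> A" for x
      proof -
        have "x \<in> section_centralizer G L B" using FA that by blast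
        then have "l \<otimes> x \<otimes> inv l \<otimes> inv x \<in> B" using l by (simp add: section_centralizer_def)
        then show ?thesis using commutator_swap_mem[OF B.subgroup_axioms] l that by simp
      qed
      then show "l \<in> ?C" using l by (simp add: section_centralizer_def)
    qed
    then show False using L(2) by blast
  qed
  moreover have "a \<in> section_centralizer G L B"
  proof -
    have ac: "a \<in> carrier G" using a by simp
    have "a \<in> section_centralizer G L B \<longleftrightarrow> (\<forall>l\<in>L. (B #> l) \<otimes>\<^bsub>G Mod B\<^esub> (B #> a) = (B #> a) \<otimes>\<^bsub>G Mod B\<^esub> (B #> l))"
      by (rule Q.mem_section_centralizer_iff[OF L.subset ac])
    moreover have "(B #> l) \<otimes>\<^bsub>G Mod B\<^esub> (B #> a) = (B #> a) \<otimes>\<^bsub>G Mod B\<^esub> (B #> l)" if l: "l \<in> L" for l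
    proof -
      obtain c s where cs: "c \<in> ?C" "s \<in> S" "l = c \<otimes> s" using sup l by blast
      have cc: "c \<in> carrier G" using cs(1) by (simp add: section_centralizer_def)
      have sc: "s \<in> carrier G" using cs(2) S by blast
      let ?Z = "{y \<in> carrier (G Mod B). (B #> a) \<otimes>\<^bsub>G Mod B\<^esub> y = y \<otimes>\<^bsub>G Mod B\<^esub> (B #> a)}"
      have Z: "subgroup ?Z (G Mod B)" by (rule Q.H.centralizer_subgroup[OF Q.hom_closed[OF ac]])
      have "(B #> a) \<otimes>\<^bsub>G Mod B\<^esub> (B #> c) = (B #> c) \<otimes>\<^bsub>G Mod B\<^esub> (B #> a)"
        using Q.mem_section_centralizer_iff[OF A.subset cc] cs(1) a by blast
      moreover have "(B #> a) \<otimes>\<^bsub>G Mod B\<^esub> (B #> s) = (B #> s) \<otimes>\<^bsub>G Mod B\<^esub> (B #> a)"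
        using Q.commute_iff[OF ac sc] fixed cs(2) by blast
      ultimately have "(B #> c) \<otimes>\<^bsub>G Mod B\<^esub> (B #> s) \<in> ?Z"
        using subgroup.m_closed[OF Z] Q.hom_closed[OF cc] Q.hom_closed[OF sc] by blast
      then show ?thesis unfolding cs(3) Q.hom_mult[OF cc sc] by simp
    qed
    ultimately show ?thesis by blast
  qed
  ultimately show ?thesis using a by blast
qed

text \<open>
  The number of fixed points of \<open>S\<close> on the \<open>p\<close>-group \<open>A/B\<close> is a multiple of \<open>p\<close>, so the trivial one is
  not alone.
\<close>

lemma (in group) p_group_fixes_point_of_p_section:
  assumes fin: "finite (carrier G)" and p: "prime p"
    and A: "A \<lhd> G" and B: "B \<lhd> G" "B \<subset> A" and pA: "p_section p G A B"
    and S: "subgroup S G" "card S = p ^ n"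
  shows "\<exists>a\<in>A. a \<notin> B \<and> (\<forall>s\<in>S. a \<otimes> s \<otimes> inv a \<otimes> inv s \<in> B)"
proof (rule ccontr)
  assume "\<not> (\<exists>a\<in>A. a \<notin> B \<and> (\<forall>s\<in>S. a \<otimes> s \<otimes> inv a \<otimes> inv s \<in> B))"
  then have free: "a \<in> B" if "a \<in> A" "\<forall>s\<in>S. a \<otimes> s \<otimes> inv a \<otimes> inv s \<in> B" for a
    using that by blast
  interpret A: normal A G by (rule A)
  define Q where "Q = G Mod B"
  define h where "h = (\<lambda>x. B #> x)"
  interpret Q: quotient_hom G Q h B unfolding Q_def h_def using quotient_hom_Mod[OF B(1)] .
  interpret S: subgroup S G by (rule S(1))
  let ?S = "G\<lparr>carrier := S\<rparr>"
  interpret SG: group ?S using subgroup_imp_group[OF S(1)] .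
  let ?Y = "h ` A"
  have nY: "?Y \<lhd> Q" using Q.normal_img[OF A] .
  interpret Y: normal ?Y Q by (rule nY)
  have finY: "finite ?Y" using A.subset fin finite_subset by blast
  define \<phi> where "\<phi> s y = h s \<otimes>\<^bsub>Q\<^esub> y \<otimes>\<^bsub>Q\<^esub> inv\<^bsub>Q\<^esub> h s" for s y
  have Yc: "y \<in> carrier Q" if "y \<in> ?Y" for y using that Y.subset by blast
  have "card ?Y mod p = card {y \<in> ?Y. \<forall>s\<in>carrier ?S. \<phi> s y = y} mod p"
  proof (rule SG.card_fixed_points_mod_prime[OF p _ finY])
    show "order ?S = p ^ n" using S(2) by (simp add: order_def)
  next
    fix s y assume "s \<in> carrier ?S" "y \<in> ?Y"
    then show "\<phi> s y \<in> ?Y" unfolding \<phi>_def using Y.inv_op_closed2[OF Q.hom_closed] by simp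
  next
    fix y assume y: "y \<in> ?Y"
    show "\<phi> \<one>\<^bsub>?S\<^esub> y = y" using Yc[OF y] by (simp add: \<phi>_def)
  next
    fix s s' y assume "s \<in> carrier ?S" "s' \<in> carrier ?S" and y: "y \<in> ?Y"
    then show "\<phi> (s \<otimes>\<^bsub>?S\<^esub> s') y = \<phi> s (\<phi> s' y)"
      using Yc[OF y] by (simp add: \<phi>_def Q.H.inv_mult_group Q.H.m_assoc)
  qed
  moreover have "{y \<in> ?Y. \<forall>s\<in>carrier ?S. \<phi> s y = y} = {\<one>\<^bsub>Q\<^esub>}"
  proof (intro equalityI subsetI)
    fix y assume "y \<in> {y \<in> ?Y. \<forall>s\<in>carrier ?S. \<phi> s y = y}"
    then obtain a where a: "a \<in> A" "y = h a" and fx: "\<And>s. s \<in> S \<Longrightarrow> \<phi> s (h a) = h a" by auto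
    have ac: "a \<in> carrier G" using a by simp
    have "a \<otimes> s \<otimes> inv a \<otimes> inv s \<in> B" if s: "s \<in> S" for s
    proof -
      have sc: "s \<in> carrier G" using s by simp
      have "h s \<otimes>\<^bsub>Q\<^esub> h a \<otimes>\<^bsub>Q\<^esub> inv\<^bsub>Q\<^esub> h s \<otimes>\<^bsub>Q\<^esub> h s = h a \<otimes>\<^bsub>Q\<^esub> h s"
        using fx[OF s] by (simp add: \<phi>_def)
      then have "h a \<otimes>\<^bsub>Q\<^esub> h s = h s \<otimes>\<^bsub>Q\<^esub> h a" using ac sc by (simp add: Q.H.m_assoc del: Q.hom_mult)
      then show ?thesis using Q.commute_iff[OF ac sc] by blast
    qed
    then have "a \<in> B" using free a(1) by blast
    then show "y \<in> {\<one>\<^bsub>Q\<^esub>}" using Q.hom_eq_one_iff[OF ac] a(2) by blast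
  next
    fix y assume "y \<in> {\<one>\<^bsub>Q\<^esub>}"
    then show "y \<in> {y \<in> ?Y. \<forall>s\<in>carrier ?S. \<phi> s y = y}"
      using Y.one_closed S.mem_carrier by (auto simp: \<phi>_def)
  qed
  ultimately have *: "card ?Y mod p = 1 mod p" by simp
  have "p_section p Q ?Y {\<one>\<^bsub>Q\<^esub>}" using Q.p_section_img_iff[OF A.subset] pA by blast
  then obtain k where k: "card ?Y = p ^ k"
    using Q.H.card_prime_power_if_p_section[OF Q.finite_img[OF fin] p Y.subgroup_axioms] by blast
  obtain a where a: "a \<in> A" "a \<notin> B" using B(2) by blast
  then have "h a \<noteq> \<one>\<^bsub>Q\<^esub>" using Q.hom_eq_one_iff[of a] A.mem_carrier by blast
  then have "card ?Y \<noteq> 1" using a(1) Y.one_closed by (metis card_1_singletonE imageI singletonD)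
  then have "p dvd card ?Y" using k by (cases k) auto
  then show False using * prime_gt_1_nat[OF p] by simp
qed

text \<open>
  Preimages of \<open>a\<close> and \<open>b\<close> can be chosen in the derived subgroup of \<open>G\<close>. Replacing them by suitable
  powers gives them orders of the required kind.
\<close>

lemma (in surj_hom) mixed_commutators_surj:
  assumes fin: "finite (carrier G)" and p: "prime p"
  shows "mixed_commutators p H \<subseteq> h ` mixed_commutators p G"
proof
  fix z assume "z \<in> mixed_commutators p H"
  then obtain a b and k m :: nat where ab: "a \<in> derived H (carrier H)" "b \<in> derived H (carrier H)"
    and pows: "a [^]\<^bsub>H\<^esub> (p ^ k) = \<one>\<^bsub>H\<^esub>" "coprime m p" "b [^]\<^bsub>H\<^esub> m = \<one>\<^bsub>H\<^esub>"
    and z: "z = a \<otimes>\<^bsub>H\<^esub> b \<otimes>\<^bsub>H\<^esub> inv\<^bsub>H\<^esub> a \<otimes>\<^bsub>H\<^esub> inv\<^bsub>H\<^esub> b"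
    unfolding mixed_commutators_def by blast
  obtain a0 where a0: "a0 \<in> derived G (carrier G)" "a = h a0" using ab(1) derived_carrier by blast
  obtain b0 where b0: "b0 \<in> derived G (carrier G)" "b = h b0" using ab(2) derived_carrier by blast
  have c: "a0 \<in> carrier G" "b0 \<in> carrier G" using a0(1) b0(1) G.derived_in_carrier by blast+
  obtain j l :: nat where a1: "(a0 [^] j) [^] (p ^ l) = \<one>" "h (a0 [^] j) = h a0"
    using lift_p_element[OF fin p c(1) pows(1)[unfolded a0(2)]] by blast
  obtain i n :: nat where b1: "(b0 [^] i) [^] n = \<one>" "h (b0 [^] i) = h b0" "coprime n p"
    using lift_p'_element[OF fin p c(2) pows(3)[unfolded b0(2)] pows(2)] by blast
  have "subgroup (derived G (carrier G)) G" using G.derived_is_subgroup by blast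
  then have "a0 [^] j \<in> derived G (carrier G)" "b0 [^] i \<in> derived G (carrier G)"
    using G.subgroup_nat_pow_closed a0(1) b0(1) by blast+
  then have "a0 [^] j \<otimes> b0 [^] i \<otimes> inv (a0 [^] j) \<otimes> inv (b0 [^] i) \<in> mixed_commutators p G"
    unfolding mixed_commutators_def using a1(1) b1(1,3) by blast
  moreover have "z = h (a0 [^] j \<otimes> b0 [^] i \<otimes> inv (a0 [^] j) \<otimes> inv (b0 [^] i))"
    using c by (simp add: z a0(2) b0(2) a1(2) b1(2))
  ultimately show "z \<in> h ` mixed_commutators p G" by blast
qed

text \<open>
  \<open>T\<close> maps onto \<open>G Mod C\<close>, so every mixed commutator of \<open>G Mod C\<close> comes from one of \<open>T\<close>.
\<close>

lemma (in group) mixed_commutators_lift: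
  assumes fin: "finite (carrier G)" and p: "prime p" and C: "C \<lhd> G" and T: "subgroup T G"
    and sup: "\<And>x. x \<in> carrier G \<Longrightarrow> \<exists>c\<in>C. \<exists>t\<in>T. x = c \<otimes> t"
    and sub: "mixed_commutators p (G\<lparr>carrier := T\<rparr>) \<subseteq> C"
  shows "mixed_commutators p G \<subseteq> C"
proof
  fix z assume z: "z \<in> mixed_commutators p G"
  define Q where "Q = G Mod C"
  define h where "h = (\<lambda>x. C #> x)"
  interpret Q: quotient_hom G Q h C unfolding Q_def h_def using quotient_hom_Mod[OF C] .
  interpret T: subgroup T G by (rule T)
  let ?T = "G\<lparr>carrier := T\<rparr>"
  have one: "h c = \<one>\<^bsub>Q\<^esub>" if "c \<in> C" for c
    using Q.hom_eq_one_iff Q.kernel_subset that by blast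
  have "h ` T = carrier Q"
  proof
    show "carrier Q \<subseteq> h ` T"
    proof
      fix y assume "y \<in> carrier Q"
      then obtain x where x: "x \<in> carrier G" "y = h x" using Q.surj by blast
      obtain c t where ct: "c \<in> C" "t \<in> T" "x = c \<otimes> t" using sup[OF x(1)] by blast
      have cc: "c \<in> carrier G" using ct(1) Q.kernel_subset by blast
      have "y = h t" using x ct cc one[OF ct(1)] by simp
      then show "y \<in> h ` T" using ct(2) by blast
    qed
  qed auto
  then interpret hT: surj_hom ?T Q h
    using Q.restrict_group_hom[OF T] by (intro surj_hom.intro surj_hom_axioms.intro) simp_all
  have "finite (carrier ?T)" using fin T.subset finite_subset by auto
  then have "mixed_commutators p Q \<subseteq> h ` C" using hT.mixed_commutators_surj[OF _ p] sub by blast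
  then have "mixed_commutators p Q \<subseteq> {\<one>\<^bsub>Q\<^esub>}" using one by blast
  then have "h z = \<one>\<^bsub>Q\<^esub>" using Q.mixed_commutators_img z by blast
  then show "z \<in> C" using Q.hom_eq_one_iff z mixed_commutators_subset_carrier by blast
qed

text \<open>
  The central step: a Sylow normalizer \<open>T\<close> supplements the centralizer of \<open>A/B\<close> but meets \<open>A\<close> only
  inside \<open>B\<close>. Hence the residual of \<open>T\<close>, being normalized by \<open>A\<close>, centralizes \<open>A/B\<close>.
\<close>

lemma (in group) mixed_commutators_centralize_chief_section:
  assumes fin: "finite (carrier G)" and sol: "solvable G" and p: "prime p"
    and A: "A \<lhd> G" "A \<subseteq> residual_norm G" and B: "B \<lhd> G" "B \<subset> A" and pA: "p_section p G A B"
    and chief: "\<And>M. M \<lhd> G \<Longrightarrow> B \<subseteq> M \<Longrightarrow> M \<subseteq> A \<Longrightarrow> M = B \<or> M = A"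
  shows "mixed_commutators p G \<subseteq> section_centralizer G A B"
proof (cases "section_centralizer G A B = carrier G")
  case True
  then show ?thesis using mixed_commutators_subset_carrier by simp
next
  case False
  let ?C = "section_centralizer G A B"
  have C: "?C \<lhd> G" using section_centralizer_normal[OF A(1) B(1)] .
  interpret A: normal A G by (rule A(1))
  interpret B: normal B G by (rule B(1))
  interpret C: normal ?C G by (rule C)
  have "?C \<subset> carrier G" using False C.subset by blast
  then obtain L q where L: "prime q" "L \<lhd> G" "?C \<subset> L" "L \<subseteq> carrier G" "p_section q G L ?C"
    by (rule exists_prime_section[OF fin sol C normal_self])
  interpret L: normal L G by (rule L(2))
  have CL: "?C \<subseteq> L" "\<not> L \<subseteq> ?C" using L(3) by auto
  obtain S a m where S: "subgroup S G" "S \<subseteq> L" "card S = q ^ a" "card L = q ^ a * m" "coprime m q"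
    and sup: "\<forall>x\<in>L. \<exists>c\<in>?C. \<exists>s\<in>S. x = c \<otimes> s"
    by (rule sylow_supplement_subgroup[OF fin L(1) C L.subgroup_axioms CL(1) L(5)])
  interpret S: subgroup S G by (rule S(1))
  have BA: "B \<subseteq> A" using B(2) by blast
  have free: "x \<in> B" if "x \<in> A" "\<forall>s\<in>S. x \<otimes> s \<otimes> inv x \<otimes> inv s \<in> B" for x
    by (rule chief_section_fixed_points[OF A(1) B(1) BA chief L(2) CL(2) sup S.subset that])
  have "q \<noteq> p"
    using p_group_fixes_point_of_p_section[OF fin p A(1) B pA S(1)] S(3) free by blast
  then have cop: "coprime (q ^ i) (p ^ j)" for i j using primes_coprime[OF L(1) p] by simp
  let ?T = "normalizer G S"
  have T: "subgroup ?T G" using normalizer_imp_subgroup[OF S.subset] .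
  have ST: "S \<subseteq> ?T"
  proof
    fix s assume s: "s \<in> S"
    have "x \<in> (\<lambda>k. s \<otimes> k \<otimes> inv s) ` S" if x: "x \<in> S" for x
    proof (rule image_eqI[of _ _ "inv s \<otimes> x \<otimes> s"])
      show "x = s \<otimes> (inv s \<otimes> x \<otimes> s) \<otimes> inv s" using s x by (simp add: m_assoc)
    qed (use s x in simp)
    then show "s \<in> ?T" using s by (auto simp: mem_normalizer_iff[OF S.subset])
  qed
  have TA: "x \<in> B" if x: "x \<in> ?T" "x \<in> A" for x
  proof (rule free[OF x(2)], rule ballI)
    fix s assume s: "s \<in> S"
    have xc: "x \<in> carrier G" and sc: "s \<in> carrier G" using x(2) s by auto
    let ?y = "x \<otimes> s \<otimes> inv x \<otimes> inv s"
    have "x \<otimes> s \<otimes> inv x \<in> S" using x(1) s mem_normalizer_iff[OF S.subset] by blast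
    then have yS: "?y \<in> S" using s by (simp add: S.m_closed)
    have "s \<otimes> inv x \<otimes> inv s \<in> A" using A.inv_op_closed2[OF sc] x(2) by simp
    then have yA: "?y \<in> A" using x(2) xc sc by (simp add: m_assoc)
    obtain k :: nat where k: "?y [^] (p ^ k) \<in> B" using pA yA unfolding p_section_def by blast
    have y1: "?y [^] (q ^ a) \<in> B"
      unfolding S(3)[symmetric] pow_card_subgroup[OF S(1) yS] by (rule B.one_closed)
    show "?y \<in> B"
      by (rule mem_subgroup_if_coprime_pows[OF B.subgroup_axioms A.mem_carrier[OF yA] y1 k cop])
  qed
  let ?R = "supersolvable_residual (G\<lparr>carrier := ?T\<rparr>)"
  have RT: "?R \<subseteq> ?T" and R: "subgroup ?R G" using residual_in_carrier[OF T] .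
  interpret R: subgroup ?R G by (rule R)
  have "?R \<subseteq> ?C"
  proof
    fix c assume c: "c \<in> ?R"
    have cc: "c \<in> carrier G" using R.mem_carrier[OF c] .
    have "x \<otimes> c \<otimes> inv x \<otimes> inv c \<in> B" if x: "x \<in> A" for x
    proof -
      have xc: "x \<in> carrier G" using x by simp
      have "x \<in> residual_norm G" using x A(2) by blast
      then have "(\<lambda>k. x \<otimes> k \<otimes> inv x) ` ?R = ?R" using T by (simp only: residual_norm_iff)
      then have "x \<otimes> c \<otimes> inv x \<in> ?R" using c by blast
      then have 1: "x \<otimes> c \<otimes> inv x \<otimes> inv c \<in> ?R" using c R.m_closed R.m_inv_closed by blast
      have "c \<otimes> inv x \<otimes> inv c \<in> A" using A.inv_op_closed2[OF cc] x by simp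
      then have "x \<otimes> c \<otimes> inv x \<otimes> inv c \<in> A" using x xc cc by (simp add: m_assoc)
      then show ?thesis using TA 1 RT by blast
    qed
    then show "c \<in> ?C" unfolding section_centralizer_def using cc by blast
  qed
  moreover have "mixed_commutators p (G\<lparr>carrier := ?T\<rparr>) \<subseteq> ?R"
    using group.mixed_commutators_subset_residual[OF subgroup_imp_group[OF T]] .
  ultimately have sub: "mixed_commutators p (G\<lparr>carrier := ?T\<rparr>) \<subseteq> ?C" by blast
  show ?thesis
  proof (rule mixed_commutators_lift[OF fin p C T _ sub])
    fix x assume "x \<in> carrier G"
    then obtain l t where lt: "l \<in> L" "t \<in> ?T" "x = l \<otimes> t"
      using frattini_argument[OF fin L(1,2) S] by blast
    obtain c s where cs: "c \<in> ?C" "s \<in> S" "l = c \<otimes> s" using sup lt(1) by blast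
    have "s \<otimes> t \<in> ?T" using subgroup.m_closed[OF T] ST cs(2) lt(2) by blast
    moreover have "x = c \<otimes> (s \<otimes> t)"
      using lt cs C.mem_carrier S.mem_carrier subgroup.mem_carrier[OF T lt(2)] by (simp add: m_assoc)
    ultimately show "\<exists>c\<in>?C. \<exists>t\<in>?T. x = c \<otimes> t" using cs(1) by blast
  qed
qed

definition mixed_residual :: "nat \<Rightarrow> ('a, 'b) monoid_scheme \<Rightarrow> 'a set" where
  "mixed_residual p G = generate G (mixed_commutators p G)"

text \<open>
  Refine \<open>A/B\<close> by a chief factor at its top. An element of order prime to \<open>p\<close> that centralizes both
  parts of a \<open>p\<close>-section centralizes the whole of it.
\<close>

lemma (in group) mixed_residual_centralizes_p_section:
  assumes fin: "finite (carrier G)" and sol: "solvable G" and p: "prime p"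
    and A: "A \<lhd> G" "A \<subseteq> residual_norm G" and B: "B \<lhd> G" "B \<subseteq> A" and pA: "p_section p G A B"
    and d: "d \<in> mixed_residual p G" "d [^] (m::nat) = \<one>" "coprime m p"
    and a: "a \<in> A"
  shows "a \<otimes> d \<otimes> inv a \<otimes> inv d \<in> B"
  using A B(2) pA a
proof (induction "card A" arbitrary: A a rule: less_induct)
  case less
  interpret A: normal A G by (rule less.prems(1))
  interpret B: normal B G by (rule B(1))
  have dc: "d \<in> carrier G"
    using d(1) generate_in_carrier[OF mixed_commutators_subset_carrier] by (simp add: mixed_residual_def)
  have ac: "a \<in> carrier G" using less.prems(5) by simp
  show ?case
  proof (cases "A = B")
    case True
    then have "d \<otimes> inv a \<otimes> inv d \<in> B" using B.inv_op_closed2[OF dc] less.prems(5) by simp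
    then show ?thesis using True less.prems(5) ac dc by (simp add: m_assoc)
  next
    case False
    let ?P = "\<lambda>M. M \<lhd> G \<and> B \<subseteq> M \<and> M \<subset> A"
    have P0: "?P B" using False less.prems(3) B(1) by blast
    have finA: "finite A" using A.subset fin finite_subset by blast
    have PA: "\<forall>M. ?P M \<longrightarrow> M \<subseteq> A" by auto
    obtain M where M: "?P M" and max: "\<forall>M'. ?P M' \<longrightarrow> M \<subseteq> M' \<longrightarrow> M' = M"
      using ex_maximal_set[of A ?P, OF finA PA P0] by blast
    have Mn: "M \<lhd> G" and BM: "B \<subseteq> M" and MA: "M \<subset> A" using M by auto
    interpret M: normal M G by (rule Mn)
    have "mixed_commutators p G \<subseteq> section_centralizer G A M"
    proof (rule mixed_commutators_centralize_chief_section[OF fin sol p less.prems(1,2) Mn MA])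
      show "p_section p G A M" using less.prems(4) BM by (auto simp: p_section_def)
      show "M' = M \<or> M' = A" if "M' \<lhd> G" "M \<subseteq> M'" "M' \<subseteq> A" for M'
        using max that BM by blast
    qed
    then have "mixed_residual p G \<subseteq> section_centralizer G A M"
      unfolding mixed_residual_def
      by (rule generate_subgroup_incl[OF _ normal_imp_subgroup[OF section_centralizer_normal[OF less.prems(1) Mn]]])
    then have cM: "a \<otimes> d \<otimes> inv a \<otimes> inv d \<in> M" (is "?c \<in> M")
      using d(1) less.prems(5) by (auto simp: section_centralizer_def)
    have cc: "?c \<in> carrier G" using cM by simp
    have "?c \<otimes> d \<otimes> inv ?c \<otimes> inv d \<in> B"
    proof (rule less.hyps[OF _ Mn _ BM _ cM])
      show "card M < card A" using MA finA by (rule psubset_card_mono[rotated])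
      show "M \<subseteq> residual_norm G" using MA less.prems(2) by blast
      show "p_section p G M B" using MA less.prems(4) by (auto simp: p_section_def)
    qed
    note cd = this
    define Q where "Q = G Mod B"
    define h where "h = (\<lambda>x. B #> x)"
    interpret Q: quotient_hom G Q h B unfolding Q_def h_def using quotient_hom_Mod[OF B(1)] .
    have comm: "h ?c \<otimes>\<^bsub>Q\<^esub> h d = h d \<otimes>\<^bsub>Q\<^esub> h ?c" using Q.commute_iff[OF cc dc] cd by blast
    obtain k :: nat where "?c [^] (p ^ k) \<in> B" using less.prems(4) cM MA by (auto simp: p_section_def)
    then have k: "h ?c [^]\<^bsub>Q\<^esub> (p ^ k) = \<one>\<^bsub>Q\<^esub>" using Q.pow_eq_one_iff[OF cc] by blast
    have hd: "h d [^]\<^bsub>Q\<^esub> m = \<one>\<^bsub>Q\<^esub>" using d(2) dc by (simp add: Q.hom_nat_pow[symmetric])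
    have "h ?c = h a \<otimes>\<^bsub>Q\<^esub> h d \<otimes>\<^bsub>Q\<^esub> inv\<^bsub>Q\<^esub> h a \<otimes>\<^bsub>Q\<^esub> inv\<^bsub>Q\<^esub> h d" using ac dc by simp
    then have "h a \<otimes>\<^bsub>Q\<^esub> h d = h d \<otimes>\<^bsub>Q\<^esub> h a"
      by (rule Q.H.commute_if_coprime_commutator[OF Q.hom_closed[OF ac] Q.hom_closed[OF dc] hd _ comm k])
        (use d(3) in simp)
    then show ?thesis using Q.commute_iff[OF ac dc] by blast
  qed
qed

section \<open>Short p-series and p-length\<close>

lemma (in group) generate_Union_normal:
  assumes "\<And>N. N \<in> \<N> \<Longrightarrow> N \<lhd> G"
  shows "generate G (\<Union>\<N>) \<lhd> G"
proof (rule normal_generateI)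
  show "\<Union>\<N> \<subseteq> carrier G" using assms subgroup.subset normal_imp_subgroup by blast
  fix h g assume "h \<in> \<Union>\<N>" and g: "g \<in> carrier G"
  then obtain N where N: "N \<in> \<N>" "h \<in> N" by blast
  then have "g \<otimes> h \<otimes> inv g \<in> N" using normal.inv_op_closed2[OF assms[OF N(1)] g] by blast
  then show "g \<otimes> h \<otimes> inv g \<in> \<Union>\<N>" using N(1) by blast
qed

lemma (in group) p_core_normal: "p_core p G \<lhd> G" and p'_core_normal: "p'_core p G \<lhd> G"
  unfolding p_core_def p'_core_def by (rule generate_Union_normal, blast)+

lemma (in group) p_core_step_normal:
  assumes "N \<lhd> G"
  shows "p_core_step p G N \<lhd> G" "p'_core_step p G N \<lhd> G"
proof -
  interpret Q: quotient_hom G "G Mod N" "\<lambda>x. N #> x" N using quotient_hom_Mod[OF assms] .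
  show "p_core_step p G N \<lhd> G"
    unfolding p_core_step_def quotient_preimage_def by (rule Q.normal_vimage[OF Q.H.p_core_normal])
  show "p'_core_step p G N \<lhd> G"
    unfolding p'_core_step_def quotient_preimage_def by (rule Q.normal_vimage[OF Q.H.p'_core_normal])
qed

lemma (in group) subset_p_core_step:
  assumes fin: "finite (carrier G)" and p: "prime p" and N: "N \<lhd> G" and B: "B \<lhd> G" "p_section p G B N"
  shows "B \<subseteq> p_core_step p G N"
proof
  interpret Q: quotient_hom G "G Mod N" "\<lambda>x. N #> x" N using quotient_hom_Mod[OF N] .
  have sB: "B \<subseteq> carrier G" using subgroup.subset[OF normal_imp_subgroup[OF B(1)]] .
  have n: "(\<lambda>x. N #> x) ` B \<lhd> G Mod N" using Q.normal_img[OF B(1)] .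
  have "\<exists>k. card ((\<lambda>x. N #> x) ` B) = p ^ k"
    using Q.H.card_prime_power_if_p_section[OF Q.finite_img[OF fin] p normal_imp_subgroup[OF n]]
      Q.p_section_img_iff[OF sB] B(2) by blast
  then have sub: "(\<lambda>x. N #> x) ` B \<subseteq> \<Union> {M. M \<lhd> G Mod N \<and> (\<exists>k. card M = p ^ k)}" using n by blast
  fix x assume x: "x \<in> B"
  then have "N #> x \<in> p_core p (G Mod N)"
    unfolding p_core_def using sub by (intro generate.incl) blast
  then show "x \<in> p_core_step p G N" using x sB by (auto simp: p_core_step_def quotient_preimage_def)
qed

lemma (in group) subset_p'_core_step:
  assumes fin: "finite (carrier G)" and p: "prime p" and N: "N \<lhd> G" and B: "B \<lhd> G" "p'_section p G B N"
  shows "B \<subseteq> p'_core_step p G N"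
proof
  interpret Q: quotient_hom G "G Mod N" "\<lambda>x. N #> x" N using quotient_hom_Mod[OF N] .
  have sB: "B \<subseteq> carrier G" using subgroup.subset[OF normal_imp_subgroup[OF B(1)]] .
  have n: "(\<lambda>x. N #> x) ` B \<lhd> G Mod N" using Q.normal_img[OF B(1)] .
  have "\<not> p dvd card ((\<lambda>x. N #> x) ` B)"
    using Q.H.card_prime_to_if_p'_section[OF Q.finite_img[OF fin] p normal_imp_subgroup[OF n]]
      Q.p'_section_img_iff[OF sB] B(2) by blast
  then have sub: "(\<lambda>x. N #> x) ` B \<subseteq> \<Union> {M. M \<lhd> G Mod N \<and> \<not> p dvd card M}" using n by blast
  fix x assume x: "x \<in> B"
  then have "N #> x \<in> p'_core p (G Mod N)"
    unfolding p'_core_def using sub by (intro generate.incl) blast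
  then show "x \<in> p'_core_step p G N" using x sB by (auto simp: p'_core_step_def quotient_preimage_def)
qed

lemma (in group) upper_series_normal: "upper_p_series p G i \<lhd> G" "upper_p'_series p G i \<lhd> G"
proof -
  show *: "upper_p_series p G i \<lhd> G" by (induction i) (simp_all add: one_is_normal p_core_step_normal)
  show "upper_p'_series p G i \<lhd> G" unfolding upper_p'_series_def using p_core_step_normal(2)[OF *] .
qed

lemma (in group) p_section_refl:
  assumes "A \<subseteq> carrier G"
  shows "p_section p G A A" "p'_section p G A A"
proof -
  have "a [^] (p ^ (0::nat)) \<in> A" "coprime 1 p \<and> a [^] (1::nat) \<in> A" if "a \<in> A" for a
    using that assms by (simp_all add: subset_iff)
  then show "p_section p G A A" "p'_section p G A A"
    unfolding p_section_def p'_section_def by blast+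
qed

text \<open>
  The terms of the upper \<open>p\<close>-series grow at least as fast as those of any normal series with factors of
  type \<open>p', p, p', p, p'\<close>. So its third \<open>p'\<close>-term is \<open>G\<close>, and only the first two \<open>p\<close>-factors can be nontrivial.
\<close>

lemma (in group) p_length_le_two:
  assumes fin: "finite (carrier G)" and p: "prime p"
    and A: "A \<lhd> G" "p'_section p G A {\<one>}" and B: "B \<lhd> G" "p_section p G B A"
    and C: "C \<lhd> G" "p'_section p G C B" and D: "D \<lhd> G" "p_section p G D C"
    and top: "p'_section p G (carrier G) D"
  shows "p_length p G \<le> 2"
proof -
  let ?P = "upper_p_series p G" and ?M = "upper_p'_series p G"
  have M: "X \<subseteq> ?M i" if "X \<lhd> G" "p'_section p G X Y" "Y \<subseteq> ?P i" for X Y i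
  proof -
    have "p'_section p G X (?P i)" using that(2,3) unfolding p'_section_def by blast
    then show ?thesis unfolding upper_p'_series_def
      using subset_p'_core_step[OF fin p upper_series_normal(1) that(1)] by blast
  qed
  have P: "X \<subseteq> ?P (Suc i)" if "X \<lhd> G" "p_section p G X Y" "Y \<subseteq> ?M i" for X Y i
  proof -
    have "p_section p G X (?M i)" using that(2,3) unfolding p_section_def by blast
    then show ?thesis
      using subset_p_core_step[OF fin p upper_series_normal(2) that(1)] by (simp add: upper_p'_series_def)
  qed
  have "A \<subseteq> ?M 0" by (rule M[OF A]) simp
  then have "B \<subseteq> ?P (Suc 0)" by (rule P[OF B])
  then have "C \<subseteq> ?M (Suc 0)" by (rule M[OF C])
  then have "D \<subseteq> ?P (Suc (Suc 0))" by (rule P[OF D])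
  then have M2: "carrier G \<subseteq> ?M (Suc (Suc 0))" by (rule M[OF normal_self top])
  note pself = p_section_refl[OF subset_refl, of p]
  have M_top: "carrier G \<subseteq> ?M (Suc (Suc i))" for i
  proof (induction i)
    case (Suc i)
    show ?case by (rule M[OF normal_self pself(2) P[OF normal_self pself(1) Suc]])
  qed (rule M2)
  have "?P (Suc i) = ?M i" if "\<not> i < 2" for i
  proof -
    have j: "i = Suc (Suc (i - 2))" using that by simp
    have Mi: "carrier G \<subseteq> ?M i" by (subst j, rule M_top)
    then have "carrier G \<subseteq> ?P (Suc i)" by (rule P[OF normal_self pself(1)])
    moreover have "?P (Suc i) \<subseteq> carrier G" "?M i \<subseteq> carrier G"
      by (rule subgroup.subset[OF normal_imp_subgroup] upper_series_normal)+
    ultimately show ?thesis using Mi by (metis subset_antisym)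
  qed
  then have "{i. ?P (Suc i) \<noteq> ?M i} \<subseteq> {..<2}" by auto
  then have "card {i. ?P (Suc i) \<noteq> ?M i} \<le> card {..<2::nat}" by (intro card_mono) auto
  then show ?thesis by (simp add: p_length_def)
qed

section \<open>The mixed residual modulo a maximal normal p'-subgroup\<close>

lemma (in group) mixed_residual_normal: "mixed_residual p G \<lhd> G"
  unfolding mixed_residual_def
proof (rule normal_generateI[OF mixed_commutators_subset_carrier])
  fix h g assume "h \<in> mixed_commutators p G" "g \<in> carrier G"
  then show "g \<otimes> h \<otimes> inv g \<in> mixed_commutators p G"
    using group_hom.mixed_commutators_img[OF conj_group_hom] by blast
qed

lemma (in group_hom) mixed_residual_img:
  assumes "x \<in> mixed_residual p G"
  shows "h x \<in> mixed_residual p H"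
proof -
  have "h x \<in> generate H (h ` mixed_commutators p G)"
    using assms generate_img[OF G.mixed_commutators_subset_carrier] by (auto simp: mixed_residual_def)
  then show ?thesis
    unfolding mixed_residual_def using H.mono_generate[OF mixed_commutators_img] by blast
qed

lemma (in quotient_hom) no_normal_p'_subgroup_if_maximal:
  assumes max: "\<forall>M. M \<lhd> G \<and> p'_section p G M N \<longrightarrow> N \<subseteq> M \<longrightarrow> M = N"
    and K: "K \<lhd> H" "p'_section p H K {\<one>\<^bsub>H\<^esub>}"
  shows "K = {\<one>\<^bsub>H\<^esub>}"
proof -
  let ?M = "{x \<in> carrier G. h x \<in> K}"
  interpret K: normal K H by (rule K(1))
  have img: "h ` ?M = K" using surj K.subset by auto
  have "p'_section p G ?M N" using p'_section_img_iff[of ?M] K(2) img by simp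
  moreover have "N \<subseteq> ?M"
  proof
    fix x assume x: "x \<in> N"
    then have "h x = \<one>\<^bsub>H\<^esub>" using hom_eq_one_iff kernel_subset by blast
    then show "x \<in> ?M" using x kernel_subset K.one_closed by auto
  qed
  ultimately have "?M = N" using max[rule_format, of ?M] normal_vimage[OF K(1)] by simp
  then have "K = h ` N" using img by simp
  then have "x = \<one>\<^bsub>H\<^esub>" if "x \<in> K" for x
    using hom_eq_one_iff kernel_subset that by blast
  then show ?thesis using K.one_closed by blast
qed

text \<open>
  Induction along the series. In the quotient by \<open>N\<^sub>i\<close>, the image of the \<open>p\<close>-section
  \<open>(N\<^sub>i\<^sub>+\<^sub>1 \<inter> P)/(N\<^sub>i\<^sub>+\<^sub>1 \<inter> N)\<close> lies in the norm, so \<open>[y, d]\<close> is an element of \<open>N\<close> times one of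
  \<open>N\<^sub>i \<inter> P\<close>. By the induction hypothesis \<open>d\<close> centralizes the latter modulo \<open>N\<close>, and coprime action
  gives the claim.
\<close>

lemma (in quotient_hom) p'_element_centralizes_residual_norm_series:
  assumes fin: "finite (carrier G)" and sol: "solvable G" and p: "prime p"
    and P: "P \<lhd> G" "N \<subseteq> P" "p_section p G P N"
    and d: "d \<in> mixed_residual p G" "d [^] (m::nat) = \<one>" "coprime m p"
    and y: "y \<in> residual_norm_series G i" "y \<in> P"
  shows "h y \<otimes>\<^bsub>H\<^esub> h d = h d \<otimes>\<^bsub>H\<^esub> h y"
  using y
proof (induction i arbitrary: y)
  case 0
  have "d \<in> carrier G" using d(1) subgroup.mem_carrier[OF normal_imp_subgroup[OF G.mixed_residual_normal]] by blast
  then show ?case using 0 by simp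
next
  case (Suc i)
  let ?N = "residual_norm_series G"
  have dc: "d \<in> carrier G" using d(1) subgroup.mem_carrier[OF normal_imp_subgroup[OF G.mixed_residual_normal]] by blast
  interpret P: normal P G by (rule P(1))
  have yc: "y \<in> carrier G" using Suc.prems(2) by simp
  define X where "X = G Mod ?N i"
  define \<pi> where "\<pi> = (\<lambda>x. ?N i #> x)"
  interpret X: quotient_hom G X \<pi> "?N i"
    unfolding X_def \<pi>_def using G.quotient_hom_Mod[OF G.residual_norm_series_normal] .
  have nS: "?N (Suc i) \<lhd> G" by (rule G.residual_norm_series_normal)
  interpret S: normal "?N (Suc i)" G by (rule nS)
  have NS: "?N (Suc i) = {x \<in> carrier G. \<pi> x \<in> residual_norm X}"
    unfolding residual_norm_series.simps(2) quotient_preimage_def X_def \<pi>_def ..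
  let ?A = "?N (Suc i) \<inter> P" let ?B = "?N (Suc i) \<inter> N"
  have nA: "\<pi> ` ?A \<lhd> X" and nB: "\<pi> ` ?B \<lhd> X"
    using X.normal_img G.normal_subgroup_intersect nS P(1) kernel_normal by blast+
  have "\<pi> y \<otimes>\<^bsub>X\<^esub> \<pi> d \<otimes>\<^bsub>X\<^esub> inv\<^bsub>X\<^esub> \<pi> y \<otimes>\<^bsub>X\<^esub> inv\<^bsub>X\<^esub> \<pi> d \<in> \<pi> ` ?B"
  proof (rule X.H.mixed_residual_centralizes_p_section[OF X.finite_img[OF fin] X.solvable_img[OF sol] p nA _ nB])
    show "\<pi> ` ?A \<subseteq> residual_norm X" using NS by blast
    show "\<pi> ` ?B \<subseteq> \<pi> ` ?A" using P(2) by blast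
    show "p_section p X (\<pi> ` ?A) (\<pi> ` ?B)"
      unfolding p_section_def
    proof
      fix z assume "z \<in> \<pi> ` ?A"
      then obtain w where w: "w \<in> ?N (Suc i)" "w \<in> P" "z = \<pi> w" by blast
      obtain k :: nat where k: "w [^] (p ^ k) \<in> N" using P(3) w(2) unfolding p_section_def by blast
      have "w [^] (p ^ k) \<in> ?N (Suc i)" using G.subgroup_nat_pow_closed[OF S.subgroup_axioms w(1)] .
      then have "\<pi> (w [^] (p ^ k)) \<in> \<pi> ` ?B" using k by blast
      then show "\<exists>k. z [^]\<^bsub>X\<^esub> (p ^ k) \<in> \<pi> ` ?B"
        using X.hom_nat_pow[OF P.mem_carrier[OF w(2)]] w(3) by auto
    qed
    show "\<pi> d \<in> mixed_residual p X" using X.mixed_residual_img[OF d(1)] .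
    show "\<pi> d [^]\<^bsub>X\<^esub> m = \<one>\<^bsub>X\<^esub>" using X.hom_nat_pow[OF dc, of m] d(2) by simp
    show "coprime m p" by (rule d(3))
    show "\<pi> y \<in> \<pi> ` ?A" using Suc.prems by blast
  qed
  moreover have "\<pi> y \<otimes>\<^bsub>X\<^esub> \<pi> d \<otimes>\<^bsub>X\<^esub> inv\<^bsub>X\<^esub> \<pi> y \<otimes>\<^bsub>X\<^esub> inv\<^bsub>X\<^esub> \<pi> d = \<pi> (y \<otimes> d \<otimes> inv y \<otimes> inv d)"
    using yc dc by simp
  ultimately obtain b where b: "b \<in> N" "\<pi> (y \<otimes> d \<otimes> inv y \<otimes> inv d) = \<pi> b" by auto
  define c where "c = y \<otimes> d \<otimes> inv y \<otimes> inv d"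
  have cc: "c \<in> carrier G" using yc dc by (simp add: c_def)
  have bc: "b \<in> carrier G" using b(1) kernel_subset by blast
  have "c \<otimes> inv b \<in> ?N i" using X.hom_eq_iff[OF cc bc] b(2) by (simp add: c_def)
  moreover have cP: "c \<in> P"
    using P.inv_op_closed2[OF dc, of "inv y"] Suc.prems(2) yc dc by (simp add: c_def G.m_assoc)
  moreover have "c \<otimes> inv b \<in> P" using cP b(1) P(2) by blast
  ultimately have "h (c \<otimes> inv b) \<otimes>\<^bsub>H\<^esub> h d = h d \<otimes>\<^bsub>H\<^esub> h (c \<otimes> inv b)" using Suc.IH by blast
  moreover have "h (c \<otimes> inv b) = h c"
    using hom_eq_one_iff[OF bc] b(1) cc bc by simp
  ultimately have comm: "h c \<otimes>\<^bsub>H\<^esub> h d = h d \<otimes>\<^bsub>H\<^esub> h c" by simp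
  obtain k :: nat where "c [^] (p ^ k) \<in> N" using P(3) cP unfolding p_section_def by blast
  then have k: "h c [^]\<^bsub>H\<^esub> (p ^ k) = \<one>\<^bsub>H\<^esub>" using pow_eq_one_iff[OF cc] by blast
  have hd: "h d [^]\<^bsub>H\<^esub> m = \<one>\<^bsub>H\<^esub>" using hom_nat_pow[OF dc, of m] d(2) by simp
  have hc: "h c = h y \<otimes>\<^bsub>H\<^esub> h d \<otimes>\<^bsub>H\<^esub> inv\<^bsub>H\<^esub> h y \<otimes>\<^bsub>H\<^esub> inv\<^bsub>H\<^esub> h d" using yc dc by (simp add: c_def)
  show ?case
    by (rule H.commute_if_coprime_commutator[OF hom_closed[OF yc] hom_closed[OF dc] hd hc comm k])
      (use d(3) in simp)
qed

text \<open>
  Let \<open>P\<close> be a normal \<open>p\<close>-subgroup of \<open>H = G/N\<close>. An element \<open>x\<close> of \<open>P\<close> with \<open>x\<^sup>e = 1\<close> and preimage \<open>y\<close> is, up to an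
  exponent prime to \<open>p\<close>, the image of \<open>y\<close> raised to the order of \<open>N\<close>. This power of \<open>y\<close> has order dividing \<open>e\<close>, so it
  lies in \<open>residual_norm_series G i\<close>. Hence the \<open>p'\<close>-elements of the mixed residual centralize the
  elements of \<open>P\<close> of order dividing \<open>e\<close>, and therefore \<open>P\<close>.
\<close>

lemma (in quotient_hom) mixed_residual_img_p_group:
  assumes fin: "finite (carrier G)" and sol: "solvable G" and p: "prime p"
    and N: "p'_section p G N {\<one>}"
    and max: "\<forall>M. M \<lhd> G \<and> p'_section p G M N \<longrightarrow> N \<subseteq> M \<longrightarrow> M = N"
    and e: "p dvd e" "p dvd (e choose 2)"
    and omega: "\<And>x. x \<in> carrier G \<Longrightarrow> x [^] e = \<one> \<Longrightarrow> x \<in> residual_norm_series G i"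
  shows "p_section p H (h ` mixed_residual p G) {\<one>\<^bsub>H\<^esub>}"
proof (rule H.p_section_if_p'_elements_centralize[OF finite_img[OF fin] solvable_img[OF sol] p])
  show "h ` mixed_residual p G \<lhd> H" using normal_img[OF G.mixed_residual_normal] .
  show "K = {\<one>\<^bsub>H\<^esub>}" if "K \<lhd> H" "p'_section p H K {\<one>\<^bsub>H\<^esub>}" for K
    using no_normal_p'_subgroup_if_maximal[OF max that] .
  fix P x d and m :: nat
  assume P: "P \<lhd> H" "P \<subseteq> h ` mixed_residual p G" "p_section p H P {\<one>\<^bsub>H\<^esub>}" and x: "x \<in> P"
    and d: "d \<in> h ` mixed_residual p G" "d [^]\<^bsub>H\<^esub> m = \<one>\<^bsub>H\<^esub>" "coprime m p"
  interpret P: normal P H by (rule P(1))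
  have sE: "subgroup (mixed_residual p G) G" using normal_imp_subgroup[OF G.mixed_residual_normal] .
  obtain d0 where d0: "d0 \<in> mixed_residual p G" "d = h d0" using d(1) by blast
  have d0c: "d0 \<in> carrier G" using subgroup.mem_carrier[OF sE d0(1)] .
  obtain j n :: nat where j: "(d0 [^] j) [^] n = \<one>" "h (d0 [^] j) = h d0" "coprime n p"
    using lift_p'_element[OF fin p d0c d(2)[unfolded d0(2)] d(3)] by blast
  have d1: "d0 [^] j \<in> mixed_residual p G" using G.subgroup_nat_pow_closed[OF sE d0(1)] .
  have dc: "d \<in> carrier H" using d0(2) d0c by simp
  let ?P = "{y \<in> carrier G. h y \<in> P}"
  have nP: "?P \<lhd> G" using normal_vimage[OF P(1)] .
  have imgP: "h ` ?P = P" using surj P.subset by auto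
  have pP: "p_section p G ?P N" using p_section_img_iff[of ?P p] P(3) imgP by simp
  have NP: "N \<subseteq> ?P"
  proof
    fix z assume z: "z \<in> N"
    then have "h z = \<one>\<^bsub>H\<^esub>" using hom_eq_one_iff kernel_subset by blast
    then show "z \<in> ?P" using z kernel_subset P.one_closed by auto
  qed
  have cop: "coprime (card N) (p ^ k)" for k
  proof -
    have "\<not> p dvd card N"
      using G.card_prime_to_if_p'_section[OF fin p normal_imp_subgroup[OF kernel_normal] N] .
    then show ?thesis using prime_imp_coprime[OF p, of "card N"] by (simp add: coprime_commute)
  qed
  show "x \<otimes>\<^bsub>H\<^esub> d = d \<otimes>\<^bsub>H\<^esub> x"
  proof (rule H.centralizes_if_centralizes_omega[OF finite_img[OF fin] solvable_img[OF sol] p e dc d(2,3)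
        P.subgroup_axioms P(3) _ _ x])
    show "d \<otimes>\<^bsub>H\<^esub> y \<otimes>\<^bsub>H\<^esub> inv\<^bsub>H\<^esub> d \<in> P" if "y \<in> P" for y using P.inv_op_closed2[OF dc that] .
    fix x assume x: "x \<in> P" "x [^]\<^bsub>H\<^esub> e = \<one>\<^bsub>H\<^esub>"
    then obtain y where y: "y \<in> ?P" "x = h y" using imgP by blast
    have yc: "y \<in> carrier G" using y(1) by simp
    have "y [^] e \<in> N" using pow_eq_one_iff[OF yc] x(2) y(2) by blast
    then have "(y [^] e) [^] card N = \<one>" using G.pow_card_subgroup[OF normal_imp_subgroup[OF kernel_normal]] by blast
    then have "(y [^] card N) [^] e = \<one>" using yc by (simp add: G.nat_pow_pow mult.commute)
    then have "y [^] card N \<in> residual_norm_series G i" using omega yc by simp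
    moreover have "y [^] card N \<in> ?P" using G.subgroup_nat_pow_closed[OF normal_imp_subgroup[OF nP] y(1)] .
    ultimately have "h (y [^] card N) \<otimes>\<^bsub>H\<^esub> h (d0 [^] j) = h (d0 [^] j) \<otimes>\<^bsub>H\<^esub> h (y [^] card N)"
      by (rule p'_element_centralizes_residual_norm_series[OF fin sol p nP NP pP d1 j(1,3)])
    then have comm: "d \<otimes>\<^bsub>H\<^esub> x [^]\<^bsub>H\<^esub> card N = x [^]\<^bsub>H\<^esub> card N \<otimes>\<^bsub>H\<^esub> d"
      using j(2) d0(2) y(2) hom_nat_pow[OF yc] by simp
    let ?Z = "{y \<in> carrier H. d \<otimes>\<^bsub>H\<^esub> y = y \<otimes>\<^bsub>H\<^esub> d}"
    have xc: "x \<in> carrier H" using x(1) by simp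
    obtain k :: nat where k: "x [^]\<^bsub>H\<^esub> (p ^ k) = \<one>\<^bsub>H\<^esub>" using P(3) x(1) by (auto simp: p_section_def)
    have "x \<in> ?Z"
      by (rule H.mem_subgroup_if_coprime_pows[OF H.centralizer_subgroup[OF dc] xc _ _ cop[of k]])
        (use comm xc k dc in simp_all)
    then show "x \<otimes>\<^bsub>H\<^esub> d = d \<otimes>\<^bsub>H\<^esub> x" by simp
  qed
qed

section \<open>Groups without mixed commutators and the bound on the p-length\<close>

lemma (in group) derived_p_group_if_no_mixed_commutators:
  assumes fin: "finite (carrier G)" and sol: "solvable G" and p: "prime p"
    and no_p': "\<And>N. N \<lhd> G \<Longrightarrow> p'_section p G N {\<one>} \<Longrightarrow> N = {\<one>}"
    and mixed: "mixed_commutators p G \<subseteq> {\<one>}"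
  shows "p_section p G (derived G (carrier G)) {\<one>}"
proof (rule p_section_if_p'_elements_centralize[OF fin sol p derived_self_is_normal no_p'])
  fix P x d and m :: nat
  assume *: "P \<subseteq> derived G (carrier G)" "p_section p G P {\<one>}" "x \<in> P" "d \<in> derived G (carrier G)"
    "d [^] m = \<one>" "coprime m p"
  obtain k :: nat where "x [^] (p ^ k) = \<one>" using *(2,3) by (auto simp: p_section_def)
  then have "x \<otimes> d \<otimes> inv x \<otimes> inv d \<in> mixed_commutators p G"
    unfolding mixed_commutators_def using * by blast
  then have "x \<otimes> d \<otimes> inv x \<otimes> inv d = \<one>" using mixed by blast
  moreover have "x \<in> carrier G" "d \<in> carrier G" using * derived_in_carrier by blast+
  ultimately show "x \<otimes> d = d \<otimes> x" using commutator_eq_one_iff by blast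
qed

text \<open>
  \<open>V\<close> consists of the elements of \<open>p\<close>-power order; these form a subgroup since they do so in the abelian
  quotient by the derived subgroup.
\<close>

lemma (in group) ex_normal_p_subgroup_with_p'_quotient:
  assumes fin: "finite (carrier G)" and p: "prime p"
    and der: "p_section p G (derived G (carrier G)) {\<one>}"
  shows "\<exists>V. V \<lhd> G \<and> p_section p G V {\<one>} \<and> p'_section p G (carrier G) V"
proof -
  let ?D = "derived G (carrier G)"
  define Y where "Y = G Mod ?D"
  define f where "f = (\<lambda>x. ?D #> x)"
  interpret Y: quotient_hom G Y f ?D
    unfolding Y_def f_def using quotient_hom_Mod[OF derived_self_is_normal] .
  interpret Yc: comm_group Y unfolding Y_def by (rule derived_quot_is_comm_group)
  let ?T = "{z \<in> carrier Y. \<exists>k::nat. z [^]\<^bsub>Y\<^esub> (p ^ k :: nat) = \<one>\<^bsub>Y\<^esub>}"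
  have T: "?T \<lhd> Y" using Y.H.normal_torsion_subgroup[OF Y.H.normal_self] Yc.m_comm by blast
  let ?V = "{x \<in> carrier G. f x \<in> ?T}"
  have V: "?V \<lhd> G" by (rule Y.normal_vimage[OF T])
  have V_iff: "x \<in> ?V \<longleftrightarrow> (\<exists>k::nat. x [^] (p ^ k) \<in> ?D)" if "x \<in> carrier G" for x
    using that Y.pow_eq_one_iff[OF that] Y.hom_closed[OF that] by blast
  have "p_section p G ?V ?D" using V_iff unfolding p_section_def by blast
  then have "p_section p G ?V {\<one>}" using p_section_trans[OF _ der] by blast
  moreover have "p'_section p G (carrier G) ?V"
    unfolding p'_section_def
  proof
    fix x assume x: "x \<in> carrier G"
    obtain a m where am: "order G = p ^ a * m" "coprime m p" using order_decompose[OF fin p] by metis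
    have "(x [^] m) [^] (p ^ a) = \<one>" using pow_order_eq_1[OF x] x by (simp add: am(1) nat_pow_pow mult.commute)
    then have "(x [^] m) [^] (p ^ a) \<in> ?D"
      using subgroup.one_closed[OF normal_imp_subgroup[OF derived_self_is_normal]] by simp
    then have "x [^] m \<in> ?V" using V_iff x by blast
    then show "\<exists>m. coprime m p \<and> x [^] m \<in> ?V" using am(2) by blast
  qed
  ultimately show ?thesis using V by blast
qed

lemma (in group) p_length_le_two_if_omega_in_residual_norm_series:
  assumes fin: "finite (carrier G)" and sol: "solvable G" and p: "prime p"
    and e: "p dvd e" "p dvd (e choose 2)"
    and omega: "\<And>x. x \<in> carrier G \<Longrightarrow> x [^] e = \<one> \<Longrightarrow> x \<in> residual_norm_series G i"
  shows "p_length p G \<le> 2"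
proof -
  let ?Q = "\<lambda>B M. M \<lhd> G \<and> p'_section p G M B"
  have sub: "\<forall>M. ?Q B M \<longrightarrow> M \<subseteq> carrier G" for B
    using subgroup.subset[OF normal_imp_subgroup] by blast
  have refl: "?Q B B" if "B \<lhd> G" for B
    using that p_section_refl(2) subgroup.subset[OF normal_imp_subgroup[OF that]] by simp
  have "?Q {\<one>} {\<one>}" by (rule refl[OF one_is_normal])
  then obtain A where A: "?Q {\<one>} A" and maxA: "\<forall>M. ?Q {\<one>} M \<longrightarrow> A \<subseteq> M \<longrightarrow> M = A"
    using ex_maximal_set[of "carrier G" "?Q {\<one>}", OF fin sub] by blast
  have nA: "A \<lhd> G" and pA: "p'_section p G A {\<one>}" using A by simp_all
  define H where "H = G Mod A"
  define h where "h = (\<lambda>x. A #> x)"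
  interpret H: quotient_hom G H h A unfolding H_def h_def using quotient_hom_Mod[OF nA] .
  have maxA': "\<forall>M. M \<lhd> G \<and> p'_section p G M A \<longrightarrow> A \<subseteq> M \<longrightarrow> M = A"
    using maxA p'_section_trans[OF _ pA] sub by blast
  have pE: "p_section p H (h ` mixed_residual p G) {\<one>\<^bsub>H\<^esub>}"
    by (rule H.mixed_residual_img_p_group[OF fin sol p pA maxA' e omega])
  define B where "B = {x \<in> carrier G. h x \<in> h ` mixed_residual p G}"
  have nB: "B \<lhd> G" unfolding B_def by (rule H.normal_vimage[OF H.normal_img[OF mixed_residual_normal]])
  have pB: "p_section p G B A"
    unfolding p_section_def
  proof
    fix x assume x: "x \<in> B"
    then obtain k :: nat where "h x [^]\<^bsub>H\<^esub> (p ^ k) = \<one>\<^bsub>H\<^esub>" using pE unfolding p_section_def B_def by blast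
    then show "\<exists>k. x [^] (p ^ k) \<in> A" using H.pow_eq_one_iff[of x] x unfolding B_def by blast
  qed
  have "mixed_commutators p G \<subseteq> mixed_residual p G"
    unfolding mixed_residual_def by (blast intro: generate.incl)
  then have mB: "mixed_commutators p G \<subseteq> B" using mixed_commutators_subset_carrier unfolding B_def by blast
  have "?Q B B" by (rule refl[OF nB])
  then obtain C where C: "?Q B C" and BC: "B \<subseteq> C" and maxC: "\<forall>M. ?Q B M \<longrightarrow> C \<subseteq> M \<longrightarrow> M = C"
    using ex_maximal_set[of "carrier G" "?Q B", OF fin sub] by blast
  have nC: "C \<lhd> G" and pC: "p'_section p G C B" using C by simp_all
  define X where "X = G Mod C"
  define f where "f = (\<lambda>x. C #> x)"
  interpret X: quotient_hom G X f C unfolding X_def f_def using quotient_hom_Mod[OF nC] .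
  have maxC': "\<forall>M. M \<lhd> G \<and> p'_section p G M C \<longrightarrow> C \<subseteq> M \<longrightarrow> M = C"
    using maxC p'_section_trans[OF _ pC] sub by blast
  have "mixed_commutators p X \<subseteq> f ` C" using X.mixed_commutators_surj[OF fin p] mB BC by blast
  also have "f ` C \<subseteq> {\<one>\<^bsub>X\<^esub>}" using X.hom_eq_one_iff X.kernel_subset by blast
  finally have mX: "mixed_commutators p X \<subseteq> {\<one>\<^bsub>X\<^esub>}" .
  have "p_section p X (derived X (carrier X)) {\<one>\<^bsub>X\<^esub>}"
    by (rule X.H.derived_p_group_if_no_mixed_commutators[OF X.finite_img[OF fin] X.solvable_img[OF sol] p
          X.no_normal_p'_subgroup_if_maximal[OF maxC'] mX])
  then obtain V where V: "V \<lhd> X" "p_section p X V {\<one>\<^bsub>X\<^esub>}" "p'_section p X (carrier X) V"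
    using X.H.ex_normal_p_subgroup_with_p'_quotient[OF X.finite_img[OF fin] p] by blast
  define D where "D = {x \<in> carrier G. f x \<in> V}"
  have nD: "D \<lhd> G" unfolding D_def by (rule X.normal_vimage[OF V(1)])
  have pD: "p_section p G D C"
    unfolding p_section_def
  proof
    fix x assume x: "x \<in> D"
    then obtain k :: nat where "f x [^]\<^bsub>X\<^esub> (p ^ k) = \<one>\<^bsub>X\<^esub>" using V(2) unfolding p_section_def D_def by blast
    then show "\<exists>k. x [^] (p ^ k) \<in> C" using X.pow_eq_one_iff[of x] x unfolding D_def by blast
  qed
  have top: "p'_section p G (carrier G) D"
    unfolding p'_section_def
  proof
    fix x assume x: "x \<in> carrier G"
    then obtain m :: nat where m: "coprime m p" "f x [^]\<^bsub>X\<^esub> m \<in> V"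
      using V(3) X.hom_closed unfolding p'_section_def by blast
    then have "x [^] m \<in> D" using X.hom_nat_pow[OF x, of m] x by (simp add: D_def)
    then show "\<exists>m. coprime m p \<and> x [^] m \<in> D" using m(1) by blast
  qed
  show ?thesis by (rule p_length_le_two[OF fin p nA pA nB pB nC pC nD pD top])
qed

lemma (in group) mem_if_cyclic_subgroup_subset:
  assumes x: "x \<in> carrier G"
    and C: "\<And>C. \<lbrakk>subgroup C G; cyclic_group (G\<lparr>carrier := C\<rparr>); card C = ord x\<rbrakk> \<Longrightarrow> C \<subseteq> K"
  shows "x \<in> K"
proof -
  have "generate G {x} \<subseteq> K"
  proof (rule C)
    show "subgroup (generate G {x}) G" using generate_is_subgroup x by simp
    show "cyclic_group (G\<lparr>carrier := generate G {x}\<rparr>)"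
      using cyclic_group_generated[of x] x by (simp add: subgroup_generated_def)
    show "card (generate G {x}) = ord x" using generate_pow_card[OF x] by simp
  qed
  then show ?thesis using generate.incl[of x "{x}" G] by blast
qed

lemma (in group) omega_subset_if_cyclic_subgroups_subset:
  assumes p: "prime p" and one: "\<one> \<in> K"
    and Cp: "\<And>C. \<lbrakk>subgroup C G; cyclic_group (G\<lparr>carrier := C\<rparr>); card C = p\<rbrakk> \<Longrightarrow> C \<subseteq> K"
    and C4: "\<And>C. \<lbrakk>p = 2; subgroup C G; cyclic_group (G\<lparr>carrier := C\<rparr>); card C = 4\<rbrakk> \<Longrightarrow> C \<subseteq> K"
    and x: "x \<in> carrier G" "x [^] (if p = 2 then 4 else p) = \<one>"
  shows "x \<in> K"
proof -
  have dvd: "ord x dvd (if p = 2 then 4 else p)" using x pow_eq_id by blast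
  consider "ord x = 1" | "ord x = p" | "p = 2" "ord x = 4"
  proof (cases "p = 2")
    case True
    then have "ord x dvd 2 ^ 2" using dvd by simp
    then obtain j where "j \<le> 2" "ord x = 2 ^ j" using divides_primepow_nat[OF two_is_prime_nat, of "ord x" 2] by blast
    then show ?thesis using that True by (auto simp: le_Suc_eq numeral_2_eq_2)
  next
    case False
    then have "ord x dvd p" using dvd by simp
    then have "ord x = 1 \<or> ord x = p" using p prime_nat_iff by blast
    then show ?thesis using that by blast
  qed
  then show ?thesis
  proof cases
    case 1
    then show ?thesis using ord_eq_1 x(1) one by blast
  next
    case 2
    show ?thesis by (rule mem_if_cyclic_subgroup_subset[OF x(1)]) (use Cp 2 in simp)
  next
    case 3
    show ?thesis by (rule mem_if_cyclic_subgroup_subset[OF x(1)]) (use C4 3 in simp)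
  qed
qed

theorem theorem5p7:
  fixes G :: "('a, 'b) monoid_scheme" and p :: nat
  assumes "Factorial_Ring.prime p"
    and "group G" and "finite (carrier G)" and "solvable G"
    and "\<And>C. \<lbrakk>subgroup C G; cyclic_group (G\<lparr>carrier := C\<rparr>); card C = p\<rbrakk>
           \<Longrightarrow> C \<subseteq> residual_norm_infinity G"
    and "\<And>C. \<lbrakk>p = 2; subgroup C G; cyclic_group (G\<lparr>carrier := C\<rparr>); card C = 4\<rbrakk>
           \<Longrightarrow> C \<subseteq> residual_norm_infinity G"
  shows "p_length p G \<le> 2"
proof -
  interpret group G by fact
  \<comment> \<open>With this exponent \<open>p\<close> divides \<open>e choose 2\<close>, which fails for \<open>e = p = 2\<close>.\<close>
  define e where "e = (if p = 2 then 4 else p)"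
  have "p > 1" using assms(1) by (rule prime_gt_1_nat)
  have e: "p dvd e" "p dvd (e choose 2)"
  proof -
    show "p dvd e" by (simp add: e_def)
    show "p dvd (e choose 2)"
    proof (cases "p = 2")
      case True
      then show ?thesis by (simp add: e_def choose_two)
    next
      case False
      then have "odd p" using prime_odd_nat[OF assms(1)] \<open>p > 1\<close> by simp
      then obtain t where t: "p = 2 * t + 1" by (rule oddE)
      have "e choose 2 = p * t" using False by (simp add: e_def choose_two t)
      then show ?thesis by simp
    qed
  qed
  obtain i where i: "residual_norm_infinity G = residual_norm_series G i"
    by (simp add: residual_norm_infinity_def)
  have one: "\<one>\<^bsub>G\<^esub> \<in> residual_norm_infinity G"
    unfolding i using subgroup.one_closed[OF normal_imp_subgroup[OF residual_norm_series_normal]] .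
  show ?thesis
  proof (rule p_length_le_two_if_omega_in_residual_norm_series[OF assms(3,4,1) e])
    fix x assume "x \<in> carrier G" "x [^]\<^bsub>G\<^esub> e = \<one>\<^bsub>G\<^esub>"
    then show "x \<in> residual_norm_series G i"
      using omega_subset_if_cyclic_subgroups_subset[OF assms(1) one assms(5,6)] unfolding i e_def by blast
  qed
qed

end
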